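(* Let $X=\ell_p(\mathbb{Z})$ $(1\le p<\infty)$ or $X=c_0(\mathbb{Z})$. Let $w=(w_n)_{n\in\mathbb{Z}}$ be a bounded sequence of scalars with $\inf_{n\in\mathbb{Z}}|w_n|>0$ and consider the bilateral weighted backward shift $$B_w:(x_n)_{n\in\mathbb{Z}}\in X\mapsto (w_{n+1}x_{n+1})_{n\in\mathbb{Z}}\in X.$$ Then $B_w$ has the shadowing property if and only if one of the following conditions holds: (A) $\displaystyle\lim_{n\to\infty}\sup_{k\in\mathbb{Z}}|w_kw_{k+1}\cdots w_{k+n}|^{\frac1n}<1$. (B) $\displaystyle\lim_{n\to\infty}\inf_{k\in\mathbb{Z}}|w_kw_{k+1}\cdots w_{k+n}|^{\frac1n}>1$. (C) $\displaystyle\lim_{n\to\infty}\sup_{k\in\mathbb{N}}|w_{-k}w_{-k-1}\cdots w_{-k-n}|^{\frac1n}<1$ and $\displaystyle\lim_{n\to\infty}\inf_{k\in\mathbb{N}}|w_kw_{k+1}\cdots w_{k+n}|^{\frac1n}>1$.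
   Context: $\mathbb{N}$ is the set of positive integers. The scalar field is $\mathbb{R}$ or $\mathbb{C}$. $c_0(\mathbb{Z})$ is the Banach space of scalar sequences $(x_n)_{n\in\mathbb{Z}}$ with $\lim_{|n|\to\infty}x_n=0$, with the supremum norm; $\ell_p(\mathbb{Z})$ is the Banach space of absolutely $p$-summable scalar sequences with the $p$-norm. The conditions on $w$ mean that $B_w$ is a well-defined bounded invertible operator on $X$. Shadowing property: for $\delta>0$, a sequence $(x_n)_{n\in\mathbb{Z}}$ in $X$ is a $\delta$-pseudotrajectory of an invertible operator $T$ if $\|Tx_n-x_{n+1}\|\le\delta$ for all $n\in\mathbb{Z}$. $T$ has the shadowing property if for every $\varepsilon>0$ there exists $\delta>0$ such that for every $\delta$-pseudotrajectory $(x_n)_{n\in\mathbb{Z}}$ of $T$ there is $x\in X$ with $\|x_n-T^nx\|<\varepsilon$ for all $n\in\mathbb{Z}$. *)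

theory Defs
  imports "HOL-Analysis.Analysis" "HOL-Library.Function_Algebras"
begin

text \<open>
  A normed space of sequences is given by its carrier \<open>X\<close> (a set of functions on the integers)
  together with its norm \<open>N\<close>; the vector operations are the pointwise ones.
\<close>

definition lp_space :: "real \<Rightarrow> (int \<Rightarrow> 'a::real_normed_field) set" where
  "lp_space p = {x. (\<lambda>n. norm (x n) powr p) summable_on UNIV}"

definition lp_norm :: "real \<Rightarrow> (int \<Rightarrow> 'a::real_normed_field) \<Rightarrow> real" where
  "lp_norm p x = (\<Sum>\<^sub>\<infinity>n. norm (x n) powr p) powr (1 / p)"

definition c0_space :: "(int \<Rightarrow> 'a::real_normed_field) set" where
  "c0_space = {x. (x \<longlongrightarrow> 0) at_top \<and> (x \<longlongrightarrow> 0) at_bot}"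

definition c0_norm :: "(int \<Rightarrow> 'a::real_normed_field) \<Rightarrow> real" where
  "c0_norm x = (SUP n. norm (x n))"

definition weighted_backward_shift ::
  "(int \<Rightarrow> 'a::real_normed_field) \<Rightarrow> (int \<Rightarrow> 'a) \<Rightarrow> (int \<Rightarrow> 'a)" where
  "weighted_backward_shift w x = (\<lambda>n. w (n + 1) * x (n + 1))"

text \<open>
  Integer powers of an operator that is a bijection of \<open>X\<close> onto itself; negative powers
  are iterates of its inverse on \<open>X\<close>.
\<close>

definition int_iterate :: "'v set \<Rightarrow> ('v \<Rightarrow> 'v) \<Rightarrow> int \<Rightarrow> 'v \<Rightarrow> 'v" where
  "int_iterate X T n = (if n \<ge> 0 then T ^^ nat n else inv_into X T ^^ nat (- n))"

definition pseudotrajectory ::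
  "'v::ab_group_add set \<Rightarrow> ('v \<Rightarrow> real) \<Rightarrow> ('v \<Rightarrow> 'v) \<Rightarrow> real \<Rightarrow> (int \<Rightarrow> 'v) \<Rightarrow> bool" where
  "pseudotrajectory X N T \<delta> x \<longleftrightarrow>
     (\<forall>n. x n \<in> X) \<and> (\<forall>n. N (T (x n) - x (n + 1)) \<le> \<delta>)"

definition shadowing_property ::
  "'v::ab_group_add set \<Rightarrow> ('v \<Rightarrow> real) \<Rightarrow> ('v \<Rightarrow> 'v) \<Rightarrow> bool" where
  "shadowing_property X N T \<longleftrightarrow>
     (\<forall>\<epsilon>>0. \<exists>\<delta>>0. \<forall>x. pseudotrajectory X N T \<delta> x \<longrightarrow>
        (\<exists>y\<in>X. \<forall>n. N (x n - int_iterate X T n y) < \<epsilon>))"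

end

theory Submission imports Defs begin

text \<open>
  Choose \<open>H\<close> with \<open>H (i + 1) = w (i + 1) * H i\<close>. An orbit \<open>y\<close> of the shift satisfies
  \<open>H (- n) * y n (- n) = const\<close>, and likewise on each line \<open>n + i = const\<close>, so shadowing amounts to solving
  on each such line a scalar linear recursion with bounded right-hand side by a bounded sequence.
  If the weights are exponentially contracting or expanding as in (A), (B) or (C), convolution with
  the Green function of this recursion does so, simultaneously on all lines and with control of the norm.
  Conversely, testing a single line with an error of constant norm gives a real sequence \<open>t\<close> with
  \<open>norm (H i) = t i - t (i + 1)\<close> and \<open>\<bar>t i\<bar> \<le> K * norm (H i)\<close>. Hence \<open>t\<close> decays exponentially as long as it
  is positive, after which \<open>- t\<close> grows exponentially. The set where \<open>t\<close> is positive is all of the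
  integers, empty, or bounded on one side; these are the three conditions. The limits in them exist by
  Fekete's lemma.
\<close>


section \<open>Sequence spaces\<close>

text \<open>Convexity puts \<open>x powr p\<close> above its tangent at \<open>c\<close>. The point
  \<open>b = 0\<close> lies outside the open half-line on which convexity is applied; there the
  claim is \<open>c powr p \<le> p * c powr p\<close>.\<close>

lemma powr_ge_tangent:
  fixes b c p :: real
  assumes "p \<ge> 1" "c > 0" "b \<ge> 0"
  shows "c powr p + p * c powr (p - 1) * (b - c) \<le> b powr p"
proof (cases "b = 0")
  case True
  have "p * c powr (p - 1) * c = p * c powr p"
    using assms by (simp add: powr_diff)
  moreover have "c powr p \<le> p * c powr p"
    using assms by simp
  ultimately show ?thesis
    using True assms by (simp add: algebra_simps)
next
  case False
  have "(p * c powr (p - 1)) * (b - c) \<le> b powr p - c powr p"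
  proof (rule convex_on_imp_above_tangent[where A = "{0<..}"])
    show "convex_on {0<..} (\<lambda>x. x powr p)"
      using assms by (intro powr_convex)
    show "((\<lambda>x. x powr p) has_field_derivative p * c powr (p - 1)) (at c within {0<..})"
      using assms by (auto intro!: derivative_eq_intros)
  qed (use assms False in \<open>auto simp: interior_open\<close>)
  then show ?thesis by simp
qed

text \<open>
  Jensen's inequality for the weights \<open>a\<close>; together with the interchange of summation it replaces
  Minkowski's inequality for infinite sums in \<open>lp_space\<close>.
\<close>

lemma infsum_powr_le:
  fixes a b :: "'m \<Rightarrow> real"
  assumes p: "p \<ge> 1" and a: "\<And>m. a m \<ge> 0" "a summable_on UNIV"
    and b: "\<And>m. b m \<ge> 0" "\<And>m. b m \<le> B"
  shows "(\<Sum>\<^sub>\<infinity>m. a m * b m) powr p \<le> (\<Sum>\<^sub>\<infinity>m. a m) powr (p - 1) * (\<Sum>\<^sub>\<infinity>m. a m * b m powr p)"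
proof -
  define A S where "A = (\<Sum>\<^sub>\<infinity>m. a m)" and "S = (\<Sum>\<^sub>\<infinity>m. a m * b m)"
  have ab: "(\<lambda>m. a m * b m) summable_on UNIV"
    by (rule summable_on_comparison_test[OF summable_on_cmult_left[OF a(2), of B]])
      (use a b in \<open>auto intro!: mult_left_mono mult_nonneg_nonneg\<close>)
  have abp: "(\<lambda>m. a m * b m powr p) summable_on UNIV"
    by (rule summable_on_comparison_test[OF summable_on_cmult_left[OF a(2), of "B powr p"]])
      (use a b p in \<open>auto intro!: mult_left_mono mult_nonneg_nonneg powr_mono2\<close>)
  have R: "0 \<le> (\<Sum>\<^sub>\<infinity>m. a m * b m powr p)"
    using a b by (intro infsum_nonneg) auto
  have A0: "A \<ge> 0" and S0: "S \<ge> 0"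
    using a b by (auto simp: A_def S_def intro!: infsum_nonneg)
  show ?thesis
  proof (cases "S = 0")
    case True
    then show ?thesis using R by (simp add: S_def)
  next
    case False
    then have S: "S > 0" using S0 by simp
    have "A \<noteq> 0"
    proof
      assume "A = 0"
      then have "a m = 0" for m
        using nonneg_infsum_le_0D[of a UNIV m] a by (auto simp: A_def)
      then show False using S by (simp add: S_def)
    qed
    then have A: "A > 0" using A0 by simp
    \<comment> \<open>This is the weighted mean of \<open>b\<close>. Averaged with the weights
      \<open>a\<close>, the linear term of the tangent at \<open>c\<close> cancels because
      \<open>c * A = S\<close>.\<close>
    define c where "c = S / A"
    have c: "c > 0" "c * A = S" using A S by (auto simp: c_def)
    have "c powr p * A = (c powr p - p * c powr (p - 1) * c) * A + p * c powr (p - 1) * S"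
      using c by (simp add: algebra_simps)
    also have "\<dots> = (\<Sum>\<^sub>\<infinity>m. (c powr p - p * c powr (p - 1) * c) * a m + p * c powr (p - 1) * (a m * b m))"
      unfolding A_def S_def
      by (subst infsum_add) (auto intro!: summable_on_cmult_right a ab simp: infsum_cmult_right')
    also have "\<dots> \<le> (\<Sum>\<^sub>\<infinity>m. a m * b m powr p)"
    proof (rule infsum_mono)
      show "(c powr p - p * c powr (p - 1) * c) * a m + p * c powr (p - 1) * (a m * b m)
          \<le> a m * b m powr p" for m
        using mult_left_mono[OF powr_ge_tangent[OF p c(1) b(1)[of m]] a(1)[of m]]
        by (simp add: algebra_simps)
    qed (auto intro!: summable_on_add summable_on_cmult_right a ab abp)
    finally have "A powr (p - 1) * (c powr p * A) \<le> A powr (p - 1) * (\<Sum>\<^sub>\<infinity>m. a m * b m powr p)"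
      by (intro mult_left_mono) auto
    moreover have "A powr (p - 1) * (c powr p * A) = (c * A) powr p"
      using A c(1) by (simp add: powr_mult powr_diff)
    ultimately show ?thesis
      by (simp add: c(2) flip: A_def S_def)
  qed
qed

section \<open>Sequence spaces carrying shifts and diagonal sums\<close>

text \<open>The interface through which the shadowing argument sees both kinds of space.
  \<open>shift_mem\<close> serves the shift and its inverse. \<open>diagonal_sum\<close> bounds
  convolution with a kernel along lines: later \<open>z m\<close> is the error at time
  \<open>n - 1 - m\<close>, so time plus index does not depend on \<open>m\<close>.\<close>

locale shift_space =
  fixes X :: "(int \<Rightarrow> 'a::{real_normed_field, banach}) set" and N :: "(int \<Rightarrow> 'a) \<Rightarrow> real"
  assumes norm_le_N: "x \<in> X \<Longrightarrow> norm (x i) \<le> N x"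
    and single_mem: "(\<lambda>j. if j = i then s else 0) \<in> X"
    and N_single_le: "N (\<lambda>j. if j = i then s else 0) \<le> norm s"
    and diff_mem: "x \<in> X \<Longrightarrow> y \<in> X \<Longrightarrow> x - y \<in> X"
    and shift_mem: "x \<in> X \<Longrightarrow> (\<And>i. norm (y i) \<le> B * norm (x (i + k))) \<Longrightarrow> y \<in> X"
    and diagonal_sum:
      "(\<And>m. z m \<in> X) \<Longrightarrow> (\<And>m. N (z m) \<le> \<delta>) \<Longrightarrow> a summable_on UNIV \<Longrightarrow>
       (\<And>i m. norm (g i m) \<le> a m) \<Longrightarrow>
       (\<lambda>i. \<Sum>\<^sub>\<infinity>m::int. g i m * z m (i + m)) \<in> X \<and>
       N (\<lambda>i. \<Sum>\<^sub>\<infinity>m. g i m * z m (i + m)) \<le> (\<Sum>\<^sub>\<infinity>m. a m) * \<delta>"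

text \<open>Every term is dominated by \<open>a m * \<delta>\<close>, so each entry of a diagonal
  sum converges absolutely.\<close>

lemma diagonal_sum_bounds:
  fixes z :: "int \<Rightarrow> int \<Rightarrow> 'a::{real_normed_field, banach}"
  assumes z: "\<And>m i. norm (z m i) \<le> \<delta>" and a: "a summable_on UNIV"
    and g: "\<And>i m. norm (g i m) \<le> a m"
  shows "(\<lambda>m. norm (g i m * z m (i + m))) summable_on UNIV"
    and "(\<lambda>m. a m * norm (z m (i + m))) summable_on UNIV"
    and "norm (\<Sum>\<^sub>\<infinity>m. g i m * z m (i + m)) \<le> (\<Sum>\<^sub>\<infinity>m. a m * norm (z m (i + m)))"
proof -
  have a0: "a m \<ge> 0" for m
    using g[of 0 m] norm_ge_zero[of "g 0 m"] by linarith
  show 2: "(\<lambda>m. a m * norm (z m (i + m))) summable_on UNIV"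
    by (rule summable_on_comparison_test[OF summable_on_cmult_left[OF a, of \<delta>]])
      (use a0 z in \<open>auto intro!: mult_left_mono mult_nonneg_nonneg\<close>)
  show 1: "(\<lambda>m. norm (g i m * z m (i + m))) summable_on UNIV"
    by (rule summable_on_comparison_test[OF 2])
      (use g in \<open>auto simp: norm_mult intro!: mult_right_mono\<close>)
  have "norm (\<Sum>\<^sub>\<infinity>m. g i m * z m (i + m)) \<le> (\<Sum>\<^sub>\<infinity>m. norm (g i m * z m (i + m)))"
    by (rule norm_infsum_bound[OF 1])
  also have "\<dots> \<le> (\<Sum>\<^sub>\<infinity>m. a m * norm (z m (i + m)))"
    by (rule infsum_mono[OF 1 2]) (use g in \<open>auto simp: norm_mult intro!: mult_right_mono\<close>)
  finally show "norm (\<Sum>\<^sub>\<infinity>m. g i m * z m (i + m)) \<le> (\<Sum>\<^sub>\<infinity>m. a m * norm (z m (i + m)))" .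
qed

section \<open>The spaces of \<open>p\<close>-summable sequences\<close>

lemma lp_norm_powr:
  assumes "p \<ge> 1"
  shows "lp_norm p x powr p = (\<Sum>\<^sub>\<infinity>i. norm (x i) powr p)"
  using assms by (simp add: lp_norm_def powr_powr infsum_nonneg)

lemma norm_le_lp_norm:
  fixes x :: "int \<Rightarrow> 'a::real_normed_field"
  assumes p: "p \<ge> 1" and x: "x \<in> lp_space p"
  shows "norm (x i) \<le> lp_norm p x"
proof -
  have "(\<Sum>j\<in>{i}. norm (x j) powr p) \<le> (\<Sum>\<^sub>\<infinity>j. norm (x j) powr p)"
    using x by (intro finite_sum_le_infsum) (auto simp: lp_space_def)
  then have "(norm (x i) powr p) powr (1 / p) \<le> lp_norm p x"
    using p unfolding lp_norm_def by (intro powr_mono2) auto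
  then show ?thesis
    using p by (simp add: powr_powr)
qed

text \<open>For the diagonal sum, Jensen's inequality is applied at each entry, then the sums over
  entries and over \<open>m\<close> are interchanged. Shifting preserves the \<open>p\<close>-norm,
  so the total is at most \<open>A powr (p - 1) * A * \<delta> powr p\<close>.\<close>

lemma shift_space_lp:
  fixes p :: real
  assumes p: "p \<ge> 1"
  shows "shift_space (lp_space p :: (int \<Rightarrow> 'a::{real_normed_field, banach}) set) (lp_norm p)"
proof
  show "norm (x i) \<le> lp_norm p x" if "x \<in> lp_space p" for x :: "int \<Rightarrow> 'a" and i
    using p that by (rule norm_le_lp_norm)
next
  fix i :: int and s :: 'a
  have *: "((\<lambda>j. norm (if j = i then s else 0) powr p) has_sum (norm s powr p)) UNIV"
    by (rule has_sum_finite_neutralI[of "{i}"]) auto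
  then show "(\<lambda>j. if j = i then s else 0) \<in> lp_space p"
    by (auto simp: lp_space_def has_sum_imp_summable)
  show "lp_norm p (\<lambda>j. if j = i then s else 0) \<le> norm s"
    using p by (simp add: lp_norm_def infsumI[OF *] powr_powr)
next
  fix x y :: "int \<Rightarrow> 'a"
  assume xy: "x \<in> lp_space p" "y \<in> lp_space p"
  \<comment> \<open>Only membership of the difference is claimed, so the crude bound by twice the
    maximum suffices.\<close>
  have "norm ((x - y) i) powr p \<le> 2 powr p * (norm (x i) powr p + norm (y i) powr p)" for i
  proof -
    have "norm ((x - y) i) \<le> 2 * max (norm (x i)) (norm (y i))"
      using norm_triangle_ineq4[of "x i" "y i"] by simp
    then have "norm ((x - y) i) powr p \<le> (2 * max (norm (x i)) (norm (y i))) powr p"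
      using p by (intro powr_mono2) auto
    also have "\<dots> = 2 powr p * max (norm (x i)) (norm (y i)) powr p"
      by (simp add: powr_mult)
    also have "\<dots> \<le> 2 powr p * (norm (x i) powr p + norm (y i) powr p)"
      by (intro mult_left_mono) (auto simp: max_def)
    finally show ?thesis .
  qed
  moreover have "(\<lambda>i. 2 powr p * (norm (x i) powr p + norm (y i) powr p)) summable_on UNIV"
    using xy by (intro summable_on_cmult_right summable_on_add) (auto simp: lp_space_def)
  ultimately show "x - y \<in> lp_space p"
    unfolding lp_space_def by (auto intro: summable_on_comparison_test)
next
  fix x y :: "int \<Rightarrow> 'a" and B k
  assume x: "x \<in> lp_space p" and y: "\<And>i. norm (y i) \<le> B * norm (x (i + k))"
  have "(\<lambda>i. norm (x (i + k)) powr p) summable_on UNIV"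
    using x by (subst summable_on_reindex_bij_witness[of _ "\<lambda>i. i - k" "\<lambda>i. i + k" UNIV "\<lambda>i. norm (x i) powr p"])
      (auto simp: lp_space_def)
  then have s: "(\<lambda>i. \<bar>B\<bar> powr p * norm (x (i + k)) powr p) summable_on UNIV"
    by (rule summable_on_cmult_right)
  have "norm (y i) powr p \<le> \<bar>B\<bar> powr p * norm (x (i + k)) powr p" for i
  proof -
    have "norm (y i) \<le> \<bar>B\<bar> * norm (x (i + k))"
      using y[of i] mult_right_mono[OF abs_ge_self[of B] norm_ge_zero[of "x (i + k)"]] by linarith
    then have "norm (y i) powr p \<le> (\<bar>B\<bar> * norm (x (i + k))) powr p"
      using p by (intro powr_mono2) auto
    then show ?thesis by (simp add: powr_mult)
  qed
  then show "y \<in> lp_space p"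
    unfolding lp_space_def by (auto intro: summable_on_comparison_test[OF s])
next
  fix z :: "int \<Rightarrow> int \<Rightarrow> 'a" and \<delta> and a :: "int \<Rightarrow> real" and g :: "int \<Rightarrow> int \<Rightarrow> 'a"
  assume z: "\<And>m. z m \<in> lp_space p" "\<And>m. lp_norm p (z m) \<le> \<delta>" and a: "a summable_on UNIV"
    and g: "\<And>i m. norm (g i m) \<le> a m"
  have a0: "a m \<ge> 0" for m
    using g[of 0 m] norm_ge_zero[of "g 0 m"] by linarith
  have \<delta>: "\<delta> \<ge> 0"
    using z(2)[of 0] order_trans[of 0 "lp_norm p (z 0)" \<delta>] by (simp add: lp_norm_def)
  have bound: "norm (z m i) \<le> \<delta>" for m i
    using norm_le_lp_norm[OF p z(1)[of m], of i] z(2)[of m] by linarith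
  define A where "A = (\<Sum>\<^sub>\<infinity>m. a m)"
  have A: "A \<ge> 0"
    using a0 by (auto simp: A_def intro!: infsum_nonneg)
  define y where "y = (\<lambda>i. \<Sum>\<^sub>\<infinity>m. g i m * z m (i + m))"
  have reindex: "((\<lambda>i. a m * norm (z m (i + m)) powr p) has_sum (a m * lp_norm p (z m) powr p)) UNIV" for m
  proof -
    have "((\<lambda>i. norm (z m i) powr p) has_sum (lp_norm p (z m) powr p)) UNIV"
      unfolding lp_norm_powr[OF p] using z(1)[of m] by (simp add: lp_space_def)
    then have "((\<lambda>i. norm (z m (i + m)) powr p) has_sum (lp_norm p (z m) powr p)) UNIV"
      by (subst has_sum_reindex_bij_witness[of _ "\<lambda>i. i - m" "\<lambda>i. i + m" UNIV "\<lambda>i. norm (z m i) powr p"])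
        auto
    then show ?thesis by (rule has_sum_cmult_right)
  qed
  have lp_le: "a m * lp_norm p (z m) powr p \<le> a m * \<delta> powr p" for m
    using a0 z(2) p by (intro mult_left_mono powr_mono2) (auto simp: lp_norm_def)
  have outer: "(\<lambda>m. a m * lp_norm p (z m) powr p) summable_on UNIV"
    by (rule summable_on_comparison_test[OF summable_on_cmult_left[OF a, of "\<delta> powr p"]])
      (use lp_le a0 in auto)
  \<comment> \<open>Summability of the nonnegative double family follows from its iterated sums and
    justifies the interchange below.\<close>
  have both: "(\<lambda>(m, i). a m * norm (z m (i + m)) powr p) summable_on UNIV \<times> UNIV"
    by (rule summable_on_SigmaI[OF _ outer]) (use reindex a0 in auto)
  then have both': "(\<lambda>(i, m). a m * norm (z m (i + m)) powr p) summable_on UNIV \<times> UNIV"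
    by (subst summable_on_swap) (simp add: case_prod_unfold)
  have rows: "(\<lambda>i. \<Sum>\<^sub>\<infinity>m. a m * norm (z m (i + m)) powr p) summable_on UNIV"
    using summable_on_Sigma_banach[OF both'] by simp
  have "(\<Sum>\<^sub>\<infinity>i. \<Sum>\<^sub>\<infinity>m. a m * norm (z m (i + m)) powr p) = (\<Sum>\<^sub>\<infinity>m. \<Sum>\<^sub>\<infinity>i. a m * norm (z m (i + m)) powr p)"
    using infsum_swap_banach[OF both'] .
  also have "\<dots> = (\<Sum>\<^sub>\<infinity>m. a m * lp_norm p (z m) powr p)"
    using infsumI[OF reindex] by simp
  also have "\<dots> \<le> (\<Sum>\<^sub>\<infinity>m. a m * \<delta> powr p)"
    by (rule infsum_mono[OF outer summable_on_cmult_left[OF a]]) (use lp_le in auto)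
  also have "\<dots> = A * \<delta> powr p"
    by (simp add: A_def infsum_cmult_left')
  finally have total: "(\<Sum>\<^sub>\<infinity>i. \<Sum>\<^sub>\<infinity>m. a m * norm (z m (i + m)) powr p) \<le> A * \<delta> powr p" .
  have y_le: "norm (y i) powr p \<le> A powr (p - 1) * (\<Sum>\<^sub>\<infinity>m. a m * norm (z m (i + m)) powr p)" for i
  proof -
    have "norm (y i) powr p \<le> (\<Sum>\<^sub>\<infinity>m. a m * norm (z m (i + m))) powr p"
      using diagonal_sum_bounds(3)[OF bound a g, where i = i] p by (intro powr_mono2) (auto simp: y_def)
    also have "\<dots> \<le> A powr (p - 1) * (\<Sum>\<^sub>\<infinity>m. a m * norm (z m (i + m)) powr p)"
      unfolding A_def by (rule infsum_powr_le[OF p a0 a _ bound]) auto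
    finally show ?thesis .
  qed
  have y: "(\<lambda>i. norm (y i) powr p) summable_on UNIV"
    by (rule summable_on_comparison_test[OF summable_on_cmult_right[OF rows]]) (use y_le in auto)
  have "(\<Sum>\<^sub>\<infinity>i. norm (y i) powr p) \<le> (\<Sum>\<^sub>\<infinity>i. A powr (p - 1) * (\<Sum>\<^sub>\<infinity>m. a m * norm (z m (i + m)) powr p))"
    by (rule infsum_mono[OF y summable_on_cmult_right[OF rows]]) (use y_le in auto)
  also have "\<dots> \<le> A powr (p - 1) * (A * \<delta> powr p)"
    using total by (auto simp: infsum_cmult_right' intro!: mult_left_mono)
  also have "\<dots> = (A * \<delta>) powr p"
    using A \<delta> by (cases "A = 0") (auto simp: powr_mult powr_diff)
  finally have "lp_norm p y \<le> ((A * \<delta>) powr p) powr (1 / p)"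
    using p unfolding lp_norm_def by (intro powr_mono2) (auto intro!: infsum_nonneg)
  then have "lp_norm p y \<le> A * \<delta>"
    using p A \<delta> by (simp add: powr_powr)
  with y show "(\<lambda>i. \<Sum>\<^sub>\<infinity>m. g i m * z m (i + m)) \<in> lp_space p \<and>
       lp_norm p (\<lambda>i. \<Sum>\<^sub>\<infinity>m. g i m * z m (i + m)) \<le> (\<Sum>\<^sub>\<infinity>m. a m) * \<delta>"
    by (simp add: lp_space_def y_def A_def)
qed

section \<open>The space of null sequences\<close>

text \<open>The supremum dominates the entries once the range is known to be bounded: the limits
  give the bound 1 outside a finite interval, and inside it the finite sum of the norms is a
  bound.\<close>

lemma c0_norm_ge:
  fixes x :: "int \<Rightarrow> 'a::real_normed_field"
  assumes "x \<in> c0_space"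
  shows "norm (x i) \<le> c0_norm x"
proof -
  have "((\<lambda>n. norm (x n)) \<longlongrightarrow> 0) at_top" "((\<lambda>n. norm (x n)) \<longlongrightarrow> 0) at_bot"
    using assms by (auto simp: c0_space_def intro: tendsto_norm_zero)
  then have "eventually (\<lambda>n. norm (x n) < 1) at_top" "eventually (\<lambda>n. norm (x n) < 1) at_bot"
    by (auto intro: order_tendstoD)
  then obtain M M' where M: "\<And>n. n \<ge> M \<Longrightarrow> norm (x n) < 1" "\<And>n. n \<le> M' \<Longrightarrow> norm (x n) < 1"
    by (auto simp: eventually_at_top_linorder eventually_at_bot_linorder)
  have "norm (x n) \<le> 1 + (\<Sum>j\<in>{M'..M}. norm (x j))" for n
  proof (cases "n \<in> {M'..M}")
    case True
    then show ?thesis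
      using member_le_sum[of n "{M'..M}" "\<lambda>j. norm (x j)"] by auto
  next
    case False
    then have "norm (x n) < 1" using M[of n] by force
    then show ?thesis
      using sum_nonneg[of "{M'..M}" "\<lambda>j. norm (x j)"] by auto
  qed
  then have "bdd_above (range (\<lambda>n. norm (x n)))"
    by (intro bdd_aboveI2)
  then show ?thesis
    unfolding c0_norm_def by (intro cSUP_upper) auto
qed

text \<open>Dominated convergence: a finite set of \<open>m\<close> carries almost all the mass of
  \<open>a\<close>. Its part of the sum tends to 0 termwise, and the rest is at most
  \<open>\<delta>\<close> times the remaining mass.\<close>

lemma tendsto_diagonal_sum:
  fixes z :: "int \<Rightarrow> int \<Rightarrow> 'a::{real_normed_field, banach}"
  assumes z: "\<And>m i. norm (z m i) \<le> \<delta>" and lim: "\<And>m. ((\<lambda>i. z m (i + m)) \<longlongrightarrow> 0) F"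
    and a: "a summable_on UNIV" and g: "\<And>i m. norm (g i m) \<le> a m"
  shows "((\<lambda>i. \<Sum>\<^sub>\<infinity>m. g i m * z m (i + m)) \<longlongrightarrow> 0) F"
proof (rule tendstoI)
  fix e :: real assume e: "e > 0"
  have a0: "a m \<ge> 0" for m
    using g[of 0 m] norm_ge_zero[of "g 0 m"] by linarith
  have \<delta>: "\<delta> \<ge> 0"
    using z[of 0 0] norm_ge_zero[of "z 0 0"] by linarith
  \<comment> \<open>Adding 1 keeps the denominator positive when
    \<open>\<delta> = 0\<close>.\<close>
  have "e / (2 * (\<delta> + 1)) > 0" using e \<delta> by simp
  from infsum_finite_approximation[OF a this] obtain M where
    M: "finite M" "dist (sum a M) (infsum a UNIV) \<le> e / (2 * (\<delta> + 1))"
    by auto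
  have split: "infsum f UNIV = sum f M + infsum f (- M)" if "f summable_on UNIV" for f :: "int \<Rightarrow> real"
    using infsum_Un_disjoint[of f M "- M"] that M(1)
    by (simp add: summable_on_subset_banach[OF that])
  have "infsum a (- M) * \<delta> \<le> e / (2 * (\<delta> + 1)) * \<delta>"
    using M \<delta> split[OF a] by (intro mult_right_mono) (auto simp: dist_real_def)
  also have "\<dots> \<le> e / 2" using e \<delta> by (simp add: field_simps)
  finally have tail: "infsum a (- M) * \<delta> \<le> e / 2" .
  have "((\<lambda>i. \<Sum>m\<in>M. a m * norm (z m (i + m))) \<longlongrightarrow> (\<Sum>m\<in>M. a m * 0)) F"
    by (intro tendsto_intros tendsto_norm_zero lim)
  then have "eventually (\<lambda>i. (\<Sum>m\<in>M. a m * norm (z m (i + m))) < e / 2) F"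
    using e by (intro order_tendstoD) auto
  then show "eventually (\<lambda>i. dist (\<Sum>\<^sub>\<infinity>m. g i m * z m (i + m)) 0 < e) F"
  proof eventually_elim
    case (elim i)
    note s = diagonal_sum_bounds(2)[OF z a g, where i = i]
    have "norm (\<Sum>\<^sub>\<infinity>m. g i m * z m (i + m)) \<le> (\<Sum>\<^sub>\<infinity>m. a m * norm (z m (i + m)))"
      by (rule diagonal_sum_bounds(3)[OF z a g])
    also have "\<dots> = (\<Sum>m\<in>M. a m * norm (z m (i + m))) + (\<Sum>\<^sub>\<infinity>m\<in>-M. a m * norm (z m (i + m)))"
      by (rule split[OF s])
    also have "(\<Sum>\<^sub>\<infinity>m\<in>-M. a m * norm (z m (i + m))) \<le> (\<Sum>\<^sub>\<infinity>m\<in>-M. a m * \<delta>)"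
      by (intro infsum_mono summable_on_subset_banach[OF s] summable_on_cmult_left
          summable_on_subset_banach[OF a]) (use z a0 in \<open>auto intro: mult_left_mono\<close>)
    also have "\<dots> = infsum a (- M) * \<delta>" by (simp add: infsum_cmult_left')
    finally show ?case using elim tail by simp
  qed
qed

lemma filterlim_int_shift:
  "filterlim (\<lambda>i::int. i + k) at_top at_top" "filterlim (\<lambda>i::int. i + k) at_bot at_bot"
  unfolding filterlim_at_top filterlim_at_bot eventually_at_top_linorder eventually_at_bot_linorder
  by (metis diff_le_eq, metis le_diff_eq)

lemma shift_space_c0:
  "shift_space (c0_space :: (int \<Rightarrow> 'a::{real_normed_field, banach}) set) c0_norm"
proof
  show "norm (x i) \<le> c0_norm x" if "x \<in> c0_space" for x :: "int \<Rightarrow> 'a" and i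
    using that by (rule c0_norm_ge)
next
  fix i :: int and s :: 'a
  show "(\<lambda>j. if j = i then s else 0) \<in> c0_space"
    unfolding c0_space_def
  proof (clarify, intro conjI)
    have "eventually (\<lambda>j. (if j = i then s else 0) = 0) at_top"
      using eventually_gt_at_top[of i] by eventually_elim auto
    then show "((\<lambda>j. if j = i then s else 0) \<longlongrightarrow> 0) at_top"
      by (rule tendsto_eventually)
    have "eventually (\<lambda>j. (if j = i then s else 0) = 0) at_bot"
      using eventually_le_at_bot[of "i - 1"] by eventually_elim auto
    then show "((\<lambda>j. if j = i then s else 0) \<longlongrightarrow> 0) at_bot"
      by (rule tendsto_eventually)
  qed
  show "c0_norm (\<lambda>j. if j = i then s else 0) \<le> norm s"
    unfolding c0_norm_def by (rule cSUP_least) auto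
next
  show "x - y \<in> c0_space" if "x \<in> c0_space" "y \<in> c0_space" for x y :: "int \<Rightarrow> 'a"
    using that tendsto_diff[of x 0 _ y 0] by (auto simp: c0_space_def fun_diff_def)
next
  fix x y :: "int \<Rightarrow> 'a" and B k
  assume x: "x \<in> c0_space" and y: "\<And>i. norm (y i) \<le> B * norm (x (i + k))"
  have "(y \<longlongrightarrow> 0) F" if "(x \<longlongrightarrow> 0) F" "filterlim (\<lambda>i. i + k) F F" for F
  proof (rule Lim_null_comparison)
    show "((\<lambda>i. B * norm (x (i + k))) \<longlongrightarrow> 0) F"
      by (intro tendsto_mult_right_zero tendsto_norm_zero filterlim_compose[OF that])
  qed (use y in auto)
  then show "y \<in> c0_space"
    using x filterlim_int_shift by (auto simp: c0_space_def)
next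
  fix z :: "int \<Rightarrow> int \<Rightarrow> 'a" and \<delta> and a :: "int \<Rightarrow> real" and g :: "int \<Rightarrow> int \<Rightarrow> 'a"
  assume z: "\<And>m. z m \<in> c0_space" "\<And>m. c0_norm (z m) \<le> \<delta>" and a: "a summable_on UNIV"
    and g: "\<And>i m. norm (g i m) \<le> a m"
  have a0: "a m \<ge> 0" for m
    using g[of 0 m] norm_ge_zero[of "g 0 m"] by linarith
  have bound: "norm (z m i) \<le> \<delta>" for m i
    using c0_norm_ge[OF z(1)[of m], of i] z(2)[of m] by linarith
  have "norm (\<Sum>\<^sub>\<infinity>m. g i m * z m (i + m)) \<le> infsum a UNIV * \<delta>" for i
  proof -
    have "(\<Sum>\<^sub>\<infinity>m. a m * norm (z m (i + m))) \<le> (\<Sum>\<^sub>\<infinity>m. a m * \<delta>)"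
      using diagonal_sum_bounds(2)[OF bound a g] bound a0
      by (intro infsum_mono summable_on_cmult_left a) (auto intro: mult_left_mono)
    then show ?thesis
      using order_trans[OF diagonal_sum_bounds(3)[OF bound a g]] by (simp add: infsum_cmult_left')
  qed
  then have "c0_norm (\<lambda>i. \<Sum>\<^sub>\<infinity>m. g i m * z m (i + m)) \<le> infsum a UNIV * \<delta>"
    unfolding c0_norm_def by (intro cSUP_least) auto
  moreover have "(\<lambda>i. \<Sum>\<^sub>\<infinity>m. g i m * z m (i + m)) \<in> c0_space"
    using z(1) unfolding c0_space_def
    by (auto intro!: tendsto_diagonal_sum[OF bound _ a g] filterlim_compose[OF _ filterlim_int_shift(1)]
        filterlim_compose[OF _ filterlim_int_shift(2)])
  ultimately show "(\<lambda>i. \<Sum>\<^sub>\<infinity>m. g i m * z m (i + m)) \<in> c0_space \<and>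
       c0_norm (\<lambda>i. \<Sum>\<^sub>\<infinity>m. g i m * z m (i + m)) \<le> infsum a UNIV * \<delta>"
    by simp
qed

section \<open>Exponential growth rates of products\<close>

text \<open>The limit is the infimum of the quotients, finite by the lower bound. For a nearly
  optimal \<open>m\<close>, write \<open>n\<close> as a multiple of \<open>m\<close> plus a
  remainder; the remainder costs a constant, which vanishes after division by
  \<open>n\<close>.\<close>

lemma fekete:
  fixes a :: "nat \<Rightarrow> real"
  assumes sub: "\<And>m n. a (m + n) \<le> a m + a n" and lower: "\<And>n. - (B * real n) \<le> a n"
  obtains l where "(\<lambda>n. a n / real n) \<longlonglongrightarrow> l"
proof
  define l where "l = (INF n\<in>{1..}. a n / real n)"
  have bdd: "bdd_below ((\<lambda>n. a n / real n) ` {1..})"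
  proof (rule bdd_belowI2)
    show "- B \<le> a n / real n" if "n \<in> {1..}" for n
      using that lower[of n] by (simp add: field_simps)
  qed
  have l_le: "l \<le> a n / real n" if "n \<ge> 1" for n
    unfolding l_def using that by (intro cINF_lower bdd) auto
  have mult: "a (k * m + r) \<le> real k * a m + a r" for k m r
  proof (induction k)
    case (Suc k)
    then show ?case using sub[of m "k * m + r"] by (simp add: algebra_simps)
  qed simp
  show "(\<lambda>n. a n / real n) \<longlonglongrightarrow> l"
  proof (rule order_tendstoI)
    show "eventually (\<lambda>n. y < a n / real n) sequentially" if "y < l" for y
      using eventually_ge_at_top[of 1] by eventually_elim (use less_le_trans[OF that l_le] in simp)
  next
    fix y assume "l < y"
    then obtain m where m: "m \<ge> 1" "a m / real m < y"
      using cINF_less_iff[OF _ bdd, of y] by (auto simp: l_def)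
    define e where "e = a m / real m"
    \<comment> \<open>Bounds \<open>a r - real r * e\<close> for every remainder
      \<open>r < m\<close>, whatever the sign of \<open>e\<close>.\<close>
    define R where "R = (\<Sum>r<m. \<bar>a r\<bar>) + real m * \<bar>e\<bar>"
    have am: "a m = real m * e" using m by (simp add: e_def)
    have upper: "a n / real n \<le> e + R / real n" if "n \<ge> 1" for n
    proof -
      have r: "\<bar>a (n mod m)\<bar> \<le> (\<Sum>r<m. \<bar>a r\<bar>)"
        using m by (intro member_le_sum[of _ _ "\<lambda>r. \<bar>a r\<bar>"]) auto
      have "- (real (n mod m) * e) \<le> real (n mod m) * \<bar>e\<bar>"
        using mult_left_mono[OF abs_ge_minus_self[of e], of "real (n mod m)"] by simp
      also have "\<dots> \<le> real m * \<bar>e\<bar>"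
        using m by (intro mult_right_mono) (auto simp: less_imp_le)
      finally have e: "- (real (n mod m) * e) \<le> real m * \<bar>e\<bar>" .
      have "a n \<le> real (n div m) * a m + a (n mod m)"
        using mult[of "n div m" m "n mod m"] by simp
      also have "real (n div m) * a m = real (n div m * m) * e"
        by (simp add: am)
      also have "real (n div m * m) = real n - real (n mod m)"
        using div_mult_mod_eq[of n m] by (metis add_diff_cancel_right' of_nat_add)
      finally have "a n \<le> e * real n + R"
        using r e by (simp add: R_def algebra_simps)
      then show ?thesis using that by (simp add: field_simps)
    qed
    have "(\<lambda>n. e + R / real n) \<longlonglongrightarrow> e + 0"
      by (intro tendsto_intros lim_const_over_n)
    then have "eventually (\<lambda>n. e + R / real n < y) sequentially"
      using m by (intro order_tendstoD) (auto simp: e_def)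
    then show "eventually (\<lambda>n. a n / real n < y) sequentially"
      using eventually_ge_at_top[of 1] by eventually_elim (use le_less_trans[OF upper] in simp)
  qed
qed

section \<open>Limits of roots versus uniform exponential decay\<close>

text \<open>Taking a positive power is increasing and is undone by the exponent
  \<open>1 / e\<close>. This moves the root outside the supremum, leaving a submultiplicative
  quantity.\<close>

lemma cSUP_powr:
  fixes f :: "'b \<Rightarrow> real"
  assumes "K \<noteq> {}" "bdd_above (f ` K)" "\<And>k. k \<in> K \<Longrightarrow> f k > 0" "e > 0"
  shows "(SUP k\<in>K. f k powr e) = (SUP k\<in>K. f k) powr e"
proof (rule antisym)
  have le: "f k \<le> (SUP k\<in>K. f k)" if "k \<in> K" for k
    using that assms(2) by (rule cSUP_upper)
  have pow: "f k powr e \<le> (SUP k\<in>K. f k) powr e" if "k \<in> K" for k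
    using le[OF that] assms(3)[OF that] assms(4) by (intro powr_mono2) auto
  then show "(SUP k\<in>K. f k powr e) \<le> (SUP k\<in>K. f k) powr e"
    using assms(1) by (intro cSUP_least) auto
  have bdd: "bdd_above ((\<lambda>k. f k powr e) ` K)"
    using pow by (rule bdd_aboveI2)
  define s where "s = (SUP k\<in>K. f k powr e)"
  have s: "f k powr e \<le> s" if "k \<in> K" for k
    unfolding s_def using that bdd by (rule cSUP_upper)
  obtain k0 where k0: "k0 \<in> K" using assms(1) by blast
  have s0: "s > 0" using less_le_trans[OF _ s[OF k0]] assms(3)[OF k0] by simp
  have "(SUP k\<in>K. f k) \<le> s powr (1 / e)"
  proof (rule cSUP_least[OF assms(1)])
    fix k assume k: "k \<in> K"
    have "(f k powr e) powr (1 / e) \<le> s powr (1 / e)"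
      using s[OF k] assms(4) by (intro powr_mono2) auto
    then show "f k \<le> s powr (1 / e)"
      using assms(3)[OF k] assms(4) by (simp add: powr_powr)
  qed
  then have "(SUP k\<in>K. f k) powr e \<le> (s powr (1 / e)) powr e"
    using le[OF k0] assms(3)[OF k0] assms(4) by (intro powr_mono2) auto
  then show "(SUP k\<in>K. f k) powr e \<le> (SUP k\<in>K. f k powr e)"
    using s0 assms(4) by (simp add: powr_powr s_def)
qed

text \<open>Inversion reverses order, and \<open>d\<close> keeps the infimum away from 0. This turns
  statements on infima into statements on suprema for the inverse weights.\<close>

lemma cSUP_inverse:
  fixes f :: "'b \<Rightarrow> real"
  assumes "K \<noteq> {}" "d > 0" "\<And>k. k \<in> K \<Longrightarrow> d \<le> f k"
  shows "(SUP k\<in>K. inverse (f k)) = inverse (INF k\<in>K. f k)"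
proof (rule antisym)
  have bdd: "bdd_below (f ` K)" using assms(3) by (rule bdd_belowI2)
  have pos: "f k > 0" if "k \<in> K" for k using assms(2) assms(3)[OF that] by simp
  have INF: "(INF k\<in>K. f k) \<ge> d" using assms by (intro cINF_greatest) auto
  then have inv: "inverse (f k) \<le> inverse (INF k\<in>K. f k)" if "k \<in> K" for k
    using cINF_lower[OF bdd that] assms(2) by (intro le_imp_inverse_le) auto
  then show "(SUP k\<in>K. inverse (f k)) \<le> inverse (INF k\<in>K. f k)"
    using assms(1) by (intro cSUP_least) auto
  define s where "s = (SUP k\<in>K. inverse (f k))"
  have bdd': "bdd_above ((\<lambda>k. inverse (f k)) ` K)" using inv by (rule bdd_aboveI2)
  have s: "inverse (f k) \<le> s" if "k \<in> K" for k
    unfolding s_def using that bdd' by (rule cSUP_upper)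
  obtain k0 where k0: "k0 \<in> K" using assms(1) by blast
  have s0: "s > 0"
    using less_le_trans[OF _ s[OF k0]] pos[OF k0] by simp
  have "inverse s \<le> (INF k\<in>K. f k)"
  proof (rule cINF_greatest[OF assms(1)])
    fix k assume k: "k \<in> K"
    show "inverse s \<le> f k"
      using le_imp_inverse_le[OF s[OF k]] pos[OF k] by simp
  qed
  then have "inverse (INF k\<in>K. f k) \<le> inverse (inverse s)"
    using s0 by (intro le_imp_inverse_le) auto
  then show "inverse (INF k\<in>K. f k) \<le> (SUP k\<in>K. inverse (f k))"
    by (simp add: s_def)
qed

text \<open>A root-free form of the growth conditions: \<open>D\<close> absorbs the small
  \<open>n\<close> as well as the mismatch between \<open>n + 1\<close> factors and an
  \<open>n\<close>-th root.\<close>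

definition exp_decay :: "(int \<Rightarrow> real) \<Rightarrow> int set \<Rightarrow> bool" where
  "exp_decay u K \<longleftrightarrow> (\<exists>D q. 0 < q \<and> q < 1 \<and> (\<forall>k\<in>K. \<forall>n. (\<Prod>j<n. u (k + int j)) \<le> D * q ^ n))"

lemma prod_power_bounds:
  fixes u :: "nat \<Rightarrow> real"
  assumes "c > 0" "\<And>i. c \<le> u i" "\<And>i. u i \<le> C"
  shows "c ^ n \<le> (\<Prod>j<n. u j)" "(\<Prod>j<n. u j) \<le> C ^ n"
proof -
  have "0 \<le> u i" for i using assms(1) assms(2)[of i] by simp
  then have "(\<Prod>j<n. c) \<le> (\<Prod>j<n. u j)" "(\<Prod>j<n. u j) \<le> (\<Prod>j<n. C)"
    using assms by (intro prod_mono; auto)+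
  then show "c ^ n \<le> (\<Prod>j<n. u j)" "(\<Prod>j<n. u j) \<le> C ^ n"
    by simp_all
qed

lemma exp_decay_of_limit:
  fixes u :: "int \<Rightarrow> real"
  assumes u: "c > 0" "\<And>i. c \<le> u i" "\<And>i. u i \<le> C"
    and lim: "(\<lambda>n. SUP k\<in>K. (\<Prod>j\<le>n. u (k + int j)) powr (1 / real n)) \<longlonglongrightarrow> L" and L: "L < 1"
  shows "exp_decay u K"
proof -
  \<comment> \<open>The midpoint of \<open>L\<close> and 1, raised to at least \<open>1/2\<close>
    because \<open>L\<close> is not known to be positive.\<close>
  define q where "q = max (1/2) ((L + 1) / 2)"
  have q: "q > 0" "q < 1" "L < q" using L by (auto simp: q_def max_def)
  have C: "C > 0" using u(1) u(2)[of 0] u(3)[of 0] by linarith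
  have P0: "0 < (\<Prod>j<n. u (k + int j))" for k n
    using less_le_trans[OF zero_less_power[OF u(1)] prod_power_bounds(1)[where u = "\<lambda>j. u (k + int j)", OF u]] .
  from order_tendstoD(2)[OF lim q(3)] obtain M where
    M: "\<And>n. n \<ge> M \<Longrightarrow> (SUP k\<in>K. (\<Prod>j\<le>n. u (k + int j)) powr (1 / real n)) < q"
    by (auto simp: eventually_sequentially)
  \<comment> \<open>The summand \<open>1 / q\<close> pays for the one factor beyond the exponent of
    the root; the other one covers all \<open>n \<le> Suc M\<close>.\<close>
  define D where "D = 1 / q + (max C 1 / q) ^ Suc M"
  have "(\<Prod>j<n. u (k + int j)) \<le> D * q ^ n" if k: "k \<in> K" for k n
  proof (cases "n > Suc M")
    case True
    then obtain m where m: "n = Suc m" "m \<ge> M" "m \<ge> 1" by (cases n) auto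
    let ?P = "\<lambda>k. \<Prod>j\<le>m. u (k + int j)"
    have "?P k powr (1 / real m) \<le> (SUP k\<in>K. ?P k powr (1 / real m))"
    proof (rule cSUP_upper[OF k], rule bdd_aboveI2)
      show "?P k powr (1 / real m) \<le> (C ^ n) powr (1 / real m)" for k
        using prod_power_bounds(2)[where u = "\<lambda>j. u (k + int j)" and n = n, OF u] P0[where k = k and n = n]
        by (intro powr_mono2) (auto simp: m(1) lessThan_Suc_atMost)
    qed
    also have "\<dots> < q" by (rule M[OF m(2)])
    finally have "(?P k powr (1 / real m)) powr real m \<le> q powr real m"
      by (intro powr_mono2) auto
    then have "?P k \<le> q ^ m"
      using P0[where k = k and n = n] m q by (simp add: powr_powr powr_realpow lessThan_Suc_atMost)
    also have "\<dots> = 1 / q * q ^ n" using q m by simp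
    also have "\<dots> \<le> D * q ^ n"
      using q C by (intro mult_right_mono) (auto simp: D_def)
    finally show ?thesis by (simp add: m(1) lessThan_Suc_atMost)
  next
    case False
    have "(\<Prod>j<n. u (k + int j)) \<le> C ^ n"
      by (rule prod_power_bounds(2)[where u = "\<lambda>j. u (k + int j)", OF u])
    also have "\<dots> \<le> max C 1 ^ n" using C by (intro power_mono) auto
    also have "\<dots> = (max C 1 / q) ^ n * q ^ n" using q by (simp add: power_divide)
    also have "\<dots> \<le> (max C 1 / q) ^ Suc M * q ^ n"
      using False q by (intro mult_right_mono power_increasing) auto
    also have "\<dots> \<le> D * q ^ n"
      using q by (intro mult_right_mono) (auto simp: D_def)
    finally show ?thesis .
  qed
  then show ?thesis unfolding exp_decay_def using q by blast
qed

text \<open>Since \<open>K\<close> is closed under successors, the supremum over \<open>K\<close> of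
  products of length \<open>n\<close> is submultiplicative in \<open>n\<close>. Fekete's lemma
  applied to its logarithm gives the limit, and the decay bounds that limit by
  \<open>ln q < 0\<close>.\<close>

lemma limit_of_exp_decay:
  fixes u :: "int \<Rightarrow> real"
  assumes u: "c > 0" "\<And>i. c \<le> u i" "\<And>i. u i \<le> C"
    and K: "K \<noteq> {}" "\<And>k. k \<in> K \<Longrightarrow> k + 1 \<in> K" and decay: "exp_decay u K"
  obtains L where "0 < L" "L < 1"
    "(\<lambda>n. SUP k\<in>K. (\<Prod>j\<le>n. u (k + int j)) powr (1 / real n)) \<longlonglongrightarrow> L"
proof -
  define P where "P k n = (\<Prod>j<n. u (k + int j))" for k n
  have P: "c ^ n \<le> P k n" "P k n \<le> C ^ n" for k n
    unfolding P_def by (rule prod_power_bounds[where u = "\<lambda>j. u (k + int j)", OF u])+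
  have P0: "P k n > 0" for k n
    using less_le_trans[OF zero_less_power[OF u(1)] P(1)] .
  have P_add: "P k (m + n) = P k m * P (k + int m) n" for k m n
    by (induction n) (auto simp: P_def algebra_simps)
  have K': "k + int m \<in> K" if "k \<in> K" for k m
  proof (induction m)
    case (Suc m)
    then show ?case using K(2)[of "k + int m"] by (simp add: add_ac)
  qed (use that in simp)
  define S where "S n = (SUP k\<in>K. P k n)" for n
  have bdd: "bdd_above ((\<lambda>k. P k n) ` K)" for n
    using P(2) by (rule bdd_aboveI2)
  have S: "P k n \<le> S n" if "k \<in> K" for k n
    unfolding S_def using that bdd by (rule cSUP_upper)
  obtain k0 where k0: "k0 \<in> K" using K(1) by blast
  have S_ge: "c ^ n \<le> S n" for n using order_trans[OF P(1) S[OF k0]] .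
  have S0: "S n > 0" for n using less_le_trans[OF P0 S[OF k0]] .
  have S_sub: "S (m + n) \<le> S m * S n" for m n
    unfolding S_def[of "m + n"]
  proof (rule cSUP_least[OF K(1)])
    show "P k (m + n) \<le> S m * S n" if "k \<in> K" for k
      unfolding P_add using S[OF that] S[OF K'[OF that]] P0[THEN less_imp_le] S0[THEN less_imp_le]
      by (intro mult_mono) auto
  qed
  obtain l where l: "(\<lambda>n. ln (S n) / real n) \<longlonglongrightarrow> l"
  proof (rule fekete)
    show "ln (S (m + n)) \<le> ln (S m) + ln (S n)" for m n
    proof -
      have "ln (S (m + n)) \<le> ln (S m * S n)"
        using S_sub[of m n] S0[of m] S0[of n] S0[of "m + n"] by (subst ln_le_cancel_iff) auto
      then show ?thesis using S0[of m] S0[of n] by (simp add: ln_mult)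
    qed
    show "- (- ln c * real n) \<le> ln (S n)" for n
    proof -
      have "ln (c ^ n) \<le> ln (S n)" using S_ge[of n] u(1) by (subst ln_le_cancel_iff) (auto simp: S0)
      then show ?thesis using u(1) by (simp add: ln_realpow mult.commute)
    qed
  qed blast
  obtain D q where q: "0 < q" "q < 1" and D: "\<And>k n. k \<in> K \<Longrightarrow> P k n \<le> D * q ^ n"
    using decay unfolding exp_decay_def P_def by blast
  have D0: "D > 0" using D[OF k0, of 0] by (simp add: P_def)
  have S_le: "S n \<le> D * q ^ n" for n
    unfolding S_def using K(1) D by (intro cSUP_least) auto
  have "l \<le> ln q"
  proof (rule tendsto_le[OF _ _ l])
    have "(\<lambda>n. ln D / real n + ln q) \<longlonglongrightarrow> 0 + ln q"
      by (intro tendsto_intros lim_const_over_n)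
    then show "(\<lambda>n. ln D / real n + ln q) \<longlonglongrightarrow> ln q" by simp
    show "eventually (\<lambda>n. ln (S n) / real n \<le> ln D / real n + ln q) sequentially"
      using eventually_ge_at_top[of 1]
    proof eventually_elim
      case (elim n)
      have "ln (S n) \<le> ln (D * q ^ n)"
        using S_le[of n] S0[of n] D0 q by (subst ln_le_cancel_iff) auto
      also have "\<dots> = ln D + real n * ln q"
        using D0 q by (simp add: ln_mult ln_realpow)
      finally show ?case using elim by (simp add: field_simps)
    qed
  qed auto
  then have "l < 0" using q ln_less_zero_iff[of q] by linarith
  \<comment> \<open>The products have \<open>Suc n\<close> factors under an \<open>n\<close>-th
    root; this correction of the exponent tends to 1.\<close>
  have "(\<lambda>n. real (Suc n) / real n) \<longlonglongrightarrow> 1"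
    by (rule LIMSEQ_Suc_n_over_n)
  then have "(\<lambda>n. exp (ln (S (Suc n)) / real (Suc n) * (real (Suc n) / real n))) \<longlonglongrightarrow> exp (l * 1)"
    by (intro tendsto_intros LIMSEQ_Suc[OF l])
  moreover have "eventually (\<lambda>n. exp (ln (S (Suc n)) / real (Suc n) * (real (Suc n) / real n)) =
      (SUP k\<in>K. (\<Prod>j\<le>n. u (k + int j)) powr (1 / real n))) sequentially"
    using eventually_ge_at_top[of 1]
  proof eventually_elim
    case (elim n)
    have "(SUP k\<in>K. (\<Prod>j\<le>n. u (k + int j)) powr (1 / real n)) = (SUP k\<in>K. P k (Suc n) powr (1 / real n))"
      by (simp add: P_def lessThan_Suc_atMost)
    also have "\<dots> = S (Suc n) powr (1 / real n)"
      unfolding S_def using elim by (intro cSUP_powr K bdd P0) auto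
    also have "\<dots> = exp (ln (S (Suc n)) / real (Suc n) * (real (Suc n) / real n))"
      using S0[of "Suc n"] by (simp add: powr_def)
    finally show ?case ..
  qed
  ultimately have "(\<lambda>n. SUP k\<in>K. (\<Prod>j\<le>n. u (k + int j)) powr (1 / real n)) \<longlonglongrightarrow> exp l"
    using tendsto_cong by force
  then show thesis using \<open>l < 0\<close> by (intro that[of "exp l"]) auto
qed

lemma SUP_limit_iff_exp_decay:
  fixes v :: "int \<Rightarrow> 'a::real_normed_field"
  assumes v: "c > 0" "\<And>i. c \<le> norm (v i)" "\<And>i. norm (v i) \<le> C"
    and K: "K \<noteq> {}" "\<And>k. k \<in> K \<Longrightarrow> k + 1 \<in> K"
  shows "(\<exists>L<1. (\<lambda>n. SUP k\<in>K. norm (\<Prod>j\<le>n. v (k + int j)) powr (1 / real n)) \<longlonglongrightarrow> L)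
    \<longleftrightarrow> exp_decay (\<lambda>i. norm (v i)) K"
  unfolding prod_norm[symmetric]
proof
  assume "exp_decay (\<lambda>i. norm (v i)) K"
  from limit_of_exp_decay[where u = "\<lambda>i. norm (v i)", OF v K this]
  show "\<exists>L<1. (\<lambda>n. SUP k\<in>K. (\<Prod>j\<le>n. norm (v (k + int j))) powr (1 / real n)) \<longlonglongrightarrow> L"
    by blast
qed (use exp_decay_of_limit[where u = "\<lambda>i. norm (v i)", OF v] in blast)

text \<open>The reciprocal of the infimum is the supremum for the inverse weights, so a limit above
  1 becomes a limit below 1.\<close>

lemma INF_limit_iff_exp_decay:
  fixes v :: "int \<Rightarrow> 'a::real_normed_field"
  assumes v: "c > 0" "\<And>i. c \<le> norm (v i)" "\<And>i. norm (v i) \<le> C"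
    and K: "K \<noteq> {}" "\<And>k. k \<in> K \<Longrightarrow> k + 1 \<in> K"
  shows "(\<exists>L>1. (\<lambda>n. INF k\<in>K. norm (\<Prod>j\<le>n. v (k + int j)) powr (1 / real n)) \<longlonglongrightarrow> L)
    \<longleftrightarrow> exp_decay (\<lambda>i. inverse (norm (v i))) K"
proof -
  let ?I = "\<lambda>n. INF k\<in>K. norm (\<Prod>j\<le>n. v (k + int j)) powr (1 / real n)"
  let ?S = "\<lambda>n. SUP k\<in>K. (\<Prod>j\<le>n. inverse (norm (v (k + int j)))) powr (1 / real n)"
  have C: "C > 0" using v(1) v(2)[of 0] v(3)[of 0] by linarith
  have u: "inverse C > 0" "inverse C \<le> inverse (norm (v i))" "inverse (norm (v i)) \<le> inverse c" for i
    using C v(1) v(2)[of i] v(3)[of i] by (auto intro!: le_imp_inverse_le)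
  have SI: "?S n = inverse (?I n)" for n
  proof -
    have "?S n = (SUP k\<in>K. inverse (norm (\<Prod>j\<le>n. v (k + int j)) powr (1 / real n)))"
      by (simp add: prod_inversef[unfolded o_def] prod_norm powr_minus inverse_powr)
    also have "\<dots> = inverse (?I n)"
    proof (rule cSUP_inverse[OF K(1)])
      show "(c ^ Suc n) powr (1 / real n) > 0" using v(1) by simp
      show "(c ^ Suc n) powr (1 / real n) \<le> norm (\<Prod>j\<le>n. v (k + int j)) powr (1 / real n)" for k
        using prod_power_bounds(1)[where u = "\<lambda>j. norm (v (k + int j))" and n = "Suc n", OF v] v(1)
        by (intro powr_mono2) (auto simp: prod_norm lessThan_Suc_atMost)
    qed
    finally show ?thesis .
  qed
  show ?thesis
  proof
    assume "\<exists>L>1. ?I \<longlonglongrightarrow> L"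
    then obtain L where L: "L > 1" "?I \<longlonglongrightarrow> L" by blast
    then have "?S \<longlonglongrightarrow> inverse L"
      unfolding SI by (intro tendsto_inverse) auto
    then show "exp_decay (\<lambda>i. inverse (norm (v i))) K"
      using L(1) by (intro exp_decay_of_limit[OF u]) (auto simp: inverse_less_1_iff)
  next
    assume "exp_decay (\<lambda>i. inverse (norm (v i))) K"
    from limit_of_exp_decay[OF u K this] obtain L where L: "0 < L" "L < 1" "?S \<longlonglongrightarrow> L" .
    then have "(\<lambda>n. inverse (?S n)) \<longlonglongrightarrow> inverse L"
      by (intro tendsto_inverse) auto
    then show "\<exists>L>1. ?I \<longlonglongrightarrow> L"
      unfolding SI using L one_less_inverse[of L] by auto
  qed
qed


section \<open>Shadowing and dichotomies\<close>

lemma int_iterate_mem: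
  assumes "bij_betw T X X" "x \<in> X"
  shows "int_iterate X T n x \<in> X"
proof -
  have T: "T y \<in> X" "inv_into X T y \<in> X" if "y \<in> X" for y
    using assms(1) that by (auto simp: bij_betw_def inv_into_into)
  have "(T ^^ m) x \<in> X" "(inv_into X T ^^ m) x \<in> X" for m
    by (induction m) (use T assms(2) in auto)
  then show ?thesis by (simp add: int_iterate_def)
qed

lemma int_iterate_step:
  assumes "bij_betw T X X" "x \<in> X"
  shows "int_iterate X T (n + 1) x = T (int_iterate X T n x)"
proof (cases "n \<ge> 0")
  case True
  then have "nat (n + 1) = Suc (nat n)" by simp
  with True show ?thesis by (simp add: int_iterate_def)
next
  case False
  define m where "m = nat (- (n + 1))"
  have m: "nat (- n) = Suc m" using False by (simp add: m_def)
  have "int_iterate X T (n + 1) x = (inv_into X T ^^ m) x"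
    using False by (auto simp: int_iterate_def m_def)
  moreover from this have "(inv_into X T ^^ m) x \<in> X"
    using int_iterate_mem[OF assms, of "n + 1"] by simp
  ultimately show ?thesis
    using False m assms(1) by (simp add: int_iterate_def bij_betw_def f_inv_into_f)
qed

text \<open>Recognizes an explicitly constructed two-sided orbit as the iterates of its value at 0.
  Going down uses injectivity of \<open>T\<close> on \<open>X\<close>.\<close>

lemma int_iterate_unique:
  assumes T: "bij_betw T X X" and x: "\<And>n. x n \<in> X" "\<And>n. x (n + 1) = T (x n)"
  shows "int_iterate X T n (x 0) = x n"
proof (induction n rule: int_induct[where k = 0])
  case base
  show ?case by (simp add: int_iterate_def)
next
  case (step1 i)
  show ?case
    using int_iterate_step[OF T x(1)[of 0], of i] x(2)[of i] step1(2) by simp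
next
  case (step2 i)
  have "T (int_iterate X T (i - 1) (x 0)) = T (x (i - 1))"
    using step2(2) x(2)[of "i - 1"] int_iterate_step[OF T x(1)[of 0], of "i - 1"] by simp
  then show ?case
    using T x(1)[of "i - 1"] int_iterate_mem[OF T x(1)[of 0], of "i - 1"]
    by (auto simp: bij_betw_def dest: inj_onD)
qed

text \<open>
  Below \<open>a i = norm (H i)\<close> for a sequence with \<open>H (i + 1) = w (i + 1) * H i\<close>, so that quotients of \<open>a\<close>
  are absolute values of products of consecutive weights. The sets \<open>UNIV\<close>, \<open>{}\<close> and \<open>{..-1}\<close> for \<open>J\<close>
  correspond to the conditions (A), (B) and (C).
\<close>

definition dichotomy :: "(int \<Rightarrow> real) \<Rightarrow> int set \<Rightarrow> bool" where
  "dichotomy a J \<longleftrightarrow> (\<exists>D q. 0 < q \<and> q < 1 \<and>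
     (\<forall>j\<in>J. \<forall>n. a j \<le> D * q ^ n * a (j - int n)) \<and>
     (\<forall>j\<in>-J. \<forall>n. a j \<le> D * q ^ n * a (j + int n)))"

lemma summable_on_power_abs:
  fixes q :: real
  assumes "0 < q" "q < 1"
  shows "(\<lambda>m::int. q ^ nat \<bar>m\<bar>) summable_on UNIV"
proof -
  have *: "(\<lambda>n. q ^ n) summable_on (UNIV :: nat set)"
    using assms by (simp add: summable_on_UNIV_nonneg_real_iff summable_geometric)
  have "(\<lambda>m::int. q ^ nat \<bar>m\<bar>) summable_on range int"
    using * by (subst summable_on_reindex) (auto simp: o_def)
  moreover have "(\<lambda>m::int. q ^ nat \<bar>m\<bar>) summable_on range (\<lambda>n. - int n)"
    using * by (subst summable_on_reindex) (auto simp: o_def inj_on_def)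
  ultimately have "(\<lambda>m::int. q ^ nat \<bar>m\<bar>) summable_on (range int \<union> range (\<lambda>n. - int n))"
    by (rule summable_on_union)
  also have "range int \<union> range (\<lambda>n. - int n) = UNIV"
    by (auto, metis int_cases2 rangeI)
  finally show ?thesis .
qed

section \<open>The weighted shift and shadowing from a dichotomy\<close>

text \<open>The weights determine \<open>H\<close> up to a nonzero factor. Products of consecutive
  weights become quotients of values of \<open>H\<close>, uniformly in both directions.\<close>

locale weighted_shift = shift_space X N
  for X :: "(int \<Rightarrow> 'a::{real_normed_field, banach}) set" and N +
  fixes w H :: "int \<Rightarrow> 'a" and c C :: real
  assumes c: "c > 0" "\<And>i. c \<le> norm (w i)" and C: "\<And>i. norm (w i) \<le> C"
    and H_nz: "H i \<noteq> 0" and H_step: "H (i + 1) = w (i + 1) * H i"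
begin

abbreviation T :: "(int \<Rightarrow> 'a) \<Rightarrow> (int \<Rightarrow> 'a)" where
  "T \<equiv> weighted_backward_shift w"

abbreviation a :: "int \<Rightarrow> real" where
  "a i \<equiv> norm (H i)"

lemma w_nz: "w i \<noteq> 0"
  using c(1) c(2)[of i] by auto

lemma C_pos: "C > 0"
  using c(1) c(2)[of 0] C[of 0] by linarith

lemma a_pos: "a i > 0"
  by (simp add: H_nz)

lemma T_mem: "x \<in> X \<Longrightarrow> T x \<in> X"
  by (rule shift_mem[of x _ C 1])
    (auto simp: weighted_backward_shift_def norm_mult C mult_right_mono)

text \<open>Inverting the shift means dividing by weights; the lower bound \<open>c\<close> keeps
  the result in \<open>X\<close>.\<close>

lemma T_bij: "bij_betw T X X"
  unfolding bij_betw_def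
proof
  show "inj_on T X"
  proof (rule inj_onI, rule ext)
    fix x y i assume "T x = T y"
    from fun_cong[OF this, of "i - 1"] show "x i = y i"
      by (simp add: weighted_backward_shift_def w_nz)
  qed
  have "x \<in> T ` X" if x: "x \<in> X" for x
  proof
    show "x = T (\<lambda>i. x (i - 1) / w i)"
      by (simp add: weighted_backward_shift_def w_nz)
    have "norm (x (i - 1) / w i) \<le> (1 / c) * norm (x (i + - 1))" for i
      using frac_le[OF norm_ge_zero order_refl c(1) c(2)[of i], of "x (i - 1)"] by (simp add: norm_divide)
    then show "(\<lambda>i. x (i - 1) / w i) \<in> X"
      by (rule shift_mem[OF x])
  qed
  then show "T ` X = X"
    using T_mem by auto
qed

text \<open>
  On each line \<open>n + i = const\<close> the equation \<open>y (n + 1) = T (y n) - z n\<close> is a scalar recursion with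
  fundamental solution \<open>inverse (H i)\<close>; the dichotomy makes the kernel below, its Green function,
  exponentially decaying.
\<close>

lemma shadowing_of_dichotomy:
  assumes "dichotomy a J"
  shows "shadowing_property X N T"
  unfolding shadowing_property_def
proof (intro allI impI)
  fix \<epsilon> :: real assume \<epsilon>: "\<epsilon> > 0"
  obtain D q where q: "0 < q" "q < 1"
    and left: "\<And>j n. j \<in> J \<Longrightarrow> a j \<le> D * q ^ n * a (j - int n)"
    and right: "\<And>j n. j \<notin> J \<Longrightarrow> a j \<le> D * q ^ n * a (j + int n)"
    using assms unfolding dichotomy_def by blast
  \<comment> \<open>An error at index \<open>j\<close> is spread to the side of \<open>j\<close> on
    which the dichotomy makes \<open>H j / H i\<close> decay. Both branches jump by the same amount
    as \<open>i\<close> passes \<open>j\<close>, so \<open>G_step\<close> does not depend on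
    \<open>J\<close>.\<close>
  define \<gamma> :: "int \<Rightarrow> int \<Rightarrow> 'a" where
    "\<gamma> i j = (if j \<in> J then (if i \<le> j then - 1 else 0) else (if i > j then 1 else 0))" for i j
  define G where "G i m = H (i + m) / H i * \<gamma> i (i + m)" for i m
  define b where "b m = D * q ^ nat \<bar>m\<bar>" for m :: int
  have D: "D \<ge> 0"
    using left[of 0 0] right[of 0 0] a_pos[of 0] by (cases "0 \<in> J") auto
  have G: "norm (G i m) \<le> b m" for i m
  proof (cases "\<gamma> i (i + m) = 0")
    case True
    then show ?thesis using D q by (simp add: G_def b_def)
  next
    case False
    then have "norm (\<gamma> i (i + m)) = 1" by (auto simp: \<gamma>_def split: if_splits)
    moreover have "a (i + m) \<le> b m * a i"
      using left[of "i + m" "nat \<bar>m\<bar>"] right[of "i + m" "nat \<bar>m\<bar>"] False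
      by (auto simp: \<gamma>_def b_def split: if_splits)
    ultimately show ?thesis
      using a_pos[of i] by (simp add: G_def norm_mult norm_divide divide_le_eq)
  qed
  have G_step: "G i m - w (i + 1) * G (i + 1) (m - 1) = (if m = 0 then - 1 else 0)" for i m
    using H_nz[of i] w_nz[of "i + 1"] by (auto simp: G_def H_step \<gamma>_def)
  have b: "b summable_on UNIV"
    unfolding b_def by (intro summable_on_cmult_right summable_on_power_abs q)
  define S where "S = infsum b UNIV"
  have S: "S \<ge> 0"
    using D q by (auto simp: S_def b_def intro!: infsum_nonneg)
  \<comment> \<open>The added 1 makes \<open>S * \<delta>\<close> strictly smaller than
    \<open>\<epsilon>\<close> and covers \<open>S = 0\<close>.\<close>
  define \<delta> where "\<delta> = \<epsilon> / (S + 1)"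
  have \<delta>: "\<delta> > 0" "S * \<delta> < \<epsilon>"
    using S \<epsilon> by (auto simp: \<delta>_def divide_simps)
  show "\<exists>\<delta>>0. \<forall>x. pseudotrajectory X N T \<delta> x \<longrightarrow>
      (\<exists>y\<in>X. \<forall>n. N (x n - int_iterate X T n y) < \<epsilon>)"
  proof (intro exI conjI allI impI)
    fix x assume x: "pseudotrajectory X N T \<delta> x"
    define z where "z n = T (x n) - x (n + 1)" for n
    have xX: "x n \<in> X" and zX: "z n \<in> X" and z: "N (z n) \<le> \<delta>" for n
      using x T_mem diff_mem by (auto simp: pseudotrajectory_def z_def)
    define y where "y n = (\<lambda>i. \<Sum>\<^sub>\<infinity>m. G i m * z (n - 1 - m) (i + m))" for n
    have y: "y n \<in> X" "N (y n) \<le> S * \<delta>" for n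
      using diagonal_sum[where z = "\<lambda>m. z (n - 1 - m)" and g = G, OF zX z b G] unfolding y_def S_def by blast+
    have z_le: "norm (z n i) \<le> \<delta>" for n i
      by (rule order_trans[OF norm_le_N[OF zX] z])
    have summ: "(\<lambda>m. G i m * z (n - 1 - m) (i + m)) summable_on UNIV" for n i
      by (rule abs_summable_summable, rule diagonal_sum_bounds(1)[where z = "\<lambda>m. z (n - 1 - m)" and g = G, OF z_le b G])
    have y_step: "y (n + 1) = T (y n) - z n" for n
    proof
      fix i
      let ?f = "\<lambda>m. w (i + 1) * (G (i + 1) (m - 1) * z (n - m) (i + m))"
      let ?g = "\<lambda>m. G i m * z (n - m) (i + m)"
      \<comment> \<open>Moving the summation index by one aligns the series for
        \<open>T (y n)\<close> with that for \<open>y (n + 1)\<close>, so that they can be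
        subtracted termwise.\<close>
      have bij: "?f summable_on UNIV \<longleftrightarrow> (\<lambda>m. w (i + 1) * (G (i + 1) m * z (n - 1 - m) (i + 1 + m))) summable_on UNIV"
        "infsum ?f UNIV = (\<Sum>\<^sub>\<infinity>m. w (i + 1) * (G (i + 1) m * z (n - 1 - m) (i + 1 + m)))"
        by (rule summable_on_reindex_bij_witness[of _ "\<lambda>m. m + 1" "\<lambda>m. m - 1"]
            infsum_reindex_bij_witness[of _ "\<lambda>m. m + 1" "\<lambda>m. m - 1"]; simp)+
      have f: "?f summable_on UNIV"
        unfolding bij by (intro summable_on_cmult_right summ)
      have g: "?g summable_on UNIV"
        using summ[of i "n + 1"] by simp
      have "T (y n) i = infsum ?f UNIV"
        unfolding bij by (simp add: y_def weighted_backward_shift_def infsum_cmult_right')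
      then have "y (n + 1) i - T (y n) i = infsum ?g UNIV - infsum ?f UNIV"
        by (simp add: y_def)
      also have "\<dots> = (\<Sum>\<^sub>\<infinity>m. ?g m - ?f m)"
        using infsum_add[OF g summable_on_uminus[THEN iffD2, OF f]] by (simp add: infsum_uminus)
      also have "\<dots> = (\<Sum>\<^sub>\<infinity>m::int. if m = 0 then - z n i else 0)"
      proof (rule infsum_cong)
        fix m
        have "?g m - ?f m = (G i m - w (i + 1) * G (i + 1) (m - 1)) * z (n - m) (i + m)"
          by (simp add: algebra_simps)
        then show "?g m - ?f m = (if m = 0 then - z n i else 0)"
          by (simp add: G_step)
      qed
      also have "\<dots> = - z n i"
        by (intro infsumI has_sum_finite_neutralI[of "{0}"]) auto
      finally show "y (n + 1) i = (T (y n) - z n) i"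
        by (simp add: algebra_simps)
    qed
    \<comment> \<open>By linearity of \<open>T\<close>, subtracting \<open>y\<close> cancels the
      error \<open>z\<close> and leaves a true orbit.\<close>
    have orbit: "x (n + 1) - y (n + 1) = T (x n - y n)" for n
      by (simp add: y_step z_def) (auto simp: fun_eq_iff weighted_backward_shift_def algebra_simps)
    have mem: "x n - y n \<in> X" for n
      using diff_mem xX y by blast
    have "int_iterate X T n (x 0 - y 0) = x n - y n" for n
      using int_iterate_unique[OF T_bij, where x = "\<lambda>n. x n - y n"] mem orbit by blast
    then have "N (x n - int_iterate X T n (x 0 - y 0)) < \<epsilon>" for n
      using y(2)[of n] \<delta>(2) by simp
    then show "\<exists>y\<in>X. \<forall>n. N (x n - int_iterate X T n y) < \<epsilon>"
      using mem by blast
  qed (use \<delta> in auto)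
qed

section \<open>A dichotomy from shadowing\<close>

lemma a_step: "c * a i \<le> a (i + 1)" "a (i + 1) \<le> C * a i"
  using c(2)[of "i + 1"] C[of "i + 1"] by (simp_all add: H_step norm_mult mult_right_mono)

text \<open>
  The pseudotrajectory below lives on the line \<open>n + i = 0\<close> and has an error of norm exactly \<open>\<delta>\<close>, with the
  phases chosen so that all increments of \<open>H i * \<xi> i\<close> are real. An orbit shadowing it contributes only
  the scalar \<open>\<kappa>\<close>, which may be replaced by the nearest real number \<open>r\<close>.
\<close>

lemma real_tracking:
  assumes "shadowing_property X N T"
  obtains K and t :: "int \<Rightarrow> real" where "\<And>i. a i = t i - t (i + 1)" "\<And>i. \<bar>t i\<bar> \<le> K * a i"
proof -
  obtain \<delta> where \<delta>: "\<delta> > 0"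
    and shadow: "\<And>x. pseudotrajectory X N T \<delta> x \<Longrightarrow> \<exists>y\<in>X. \<forall>n. N (x n - int_iterate X T n y) < 1"
    using assms unfolding shadowing_property_def by (metis zero_less_one)
  \<comment> \<open>A discrete antiderivative of \<open>- a\<close>, normalized by
    \<open>s 0 = 0\<close>.\<close>
  define s where "s i = (if i \<ge> 0 then - (\<Sum>j\<in>{0..<i}. a j) else (\<Sum>j\<in>{i..<0}. a j))" for i
  have s: "s i - s (i + 1) = a i" for i
  proof (cases "i \<ge> 0")
    case True
    then have "{0..<i + 1} = insert i {0..<i}" by auto
    with True show ?thesis by (simp add: s_def)
  next
    case False
    then have "{i..<0} = insert i {i + 1..<0}" by auto
    with False show ?thesis by (auto simp: s_def)
  qed
  define \<xi> where "\<xi> i = of_real (\<delta> * s i) / H i" for i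
  define x where "x n = (\<lambda>i. if i = - n then \<xi> i else 0)" for n
  have \<xi>: "w i * \<xi> i - \<xi> (i - 1) = of_real (\<delta> * - a (i - 1)) / H (i - 1)" for i
  proof -
    have "w i * \<xi> i - \<xi> (i - 1) = (of_real (\<delta> * s i) - of_real (\<delta> * s (i - 1))) / H (i - 1)"
      using H_step[of "i - 1"] H_nz[of "i - 1"] w_nz[of i] by (simp add: \<xi>_def field_simps)
    also have "of_real (\<delta> * s i) - of_real (\<delta> * s (i - 1)) = (of_real (\<delta> * (s i - s (i - 1))) :: 'a)"
      by (simp add: right_diff_distrib)
    also have "s i - s (i - 1) = - a (i - 1)"
      using s[of "i - 1"] by simp
    finally show ?thesis .
  qed
  have x_eq: "x n = (\<lambda>j. if j = - n then \<xi> (- n) else 0)" for n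
    by (auto simp: x_def)
  have diff: "T (x n) - x (n + 1) = (\<lambda>j. if j = - n - 1 then w (- n) * \<xi> (- n) - \<xi> (- n - 1) else 0)" for n
    by (auto simp: x_def weighted_backward_shift_def fun_eq_iff)
  have "N (T (x n) - x (n + 1)) \<le> norm (w (- n) * \<xi> (- n) - \<xi> (- n - 1))" for n
    unfolding diff by (rule N_single_le)
  also have "norm (w (- n) * \<xi> (- n) - \<xi> (- n - 1)) = \<delta>" for n
    using \<delta> H_nz[of "- n - 1"] by (simp add: \<xi> norm_divide norm_mult)
  finally have "pseudotrajectory X N T \<delta> x"
    unfolding pseudotrajectory_def x_eq using single_mem by auto
  then obtain y where y: "y \<in> X" "\<And>n. N (x n - int_iterate X T n y) < 1"
    using shadow by blast
  define v where "v n = int_iterate X T n y" for n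
  have v: "v n \<in> X" "v (n + 1) = T (v n)" for n
    using int_iterate_mem[OF T_bij y(1)] int_iterate_step[OF T_bij y(1)] by (auto simp: v_def)
  have const: "H (- n) * v n (- n) = H (- n - 1) * v (n + 1) (- n - 1)" for n
    using H_step[of "- n - 1"] by (simp add: v weighted_backward_shift_def)
  define \<kappa> where "\<kappa> = H 0 * v 0 0"
  have \<kappa>: "H (- n) * v n (- n) = \<kappa>" for n
  proof (induction n rule: int_induct[where k = 0])
    case (step1 i)
    then show ?case using const[of i] by simp
  next
    case (step2 i)
    then show ?case using const[of "i - 1"] by simp
  qed (simp add: \<kappa>_def)
  define \<phi> where "\<phi> r = norm (of_real r - \<kappa>)" for r
  have near: "\<phi> (\<delta> * s i) \<le> a i" for i
  proof -
    have "norm ((x (- i) - v (- i)) i) \<le> N (x (- i) - v (- i))"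
      by (intro norm_le_N diff_mem v) (simp add: x_eq single_mem)
    also have "\<dots> < 1" using y(2) by (simp add: v_def)
    also have "(x (- i) - v (- i)) i = (of_real (\<delta> * s i) - \<kappa>) / H i"
      using \<kappa>[of "- i"] H_nz[of i] by (simp add: x_def \<xi>_def field_simps)
    finally show ?thesis
      using a_pos[of i] by (simp add: norm_divide \<phi>_def)
  qed
  \<comment> \<open>The minimizer \<open>r\<close> plays the part of the real part of
    \<open>\<kappa>\<close>. Outside this interval \<open>\<phi>\<close> is at least
    \<open>norm \<kappa> = \<phi> 0\<close>, so the minimum over the interval is global.\<close>
  have "continuous_on {- 2 * norm \<kappa>..2 * norm \<kappa>} \<phi>"
    unfolding \<phi>_def by (intro continuous_intros)
  from continuous_attains_inf[OF compact_Icc _ this] obtain r where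
    r: "\<forall>t\<in>{- 2 * norm \<kappa>..2 * norm \<kappa>}. \<phi> r \<le> \<phi> t"
    by force
  have min: "\<phi> r \<le> \<phi> t" for t
  proof (cases "t \<in> {- 2 * norm \<kappa>..2 * norm \<kappa>}")
    case False
    have "\<phi> r \<le> norm \<kappa>"
      using r[rule_format, of 0] by (simp add: \<phi>_def)
    also have "\<dots> \<le> \<phi> t"
      using False norm_triangle_ineq2[of "of_real t" \<kappa>] by (auto simp: \<phi>_def)
    finally show ?thesis .
  qed (use r in blast)
  have close: "\<bar>\<delta> * s i - r\<bar> \<le> 2 * a i" for i
  proof -
    have "\<bar>\<delta> * s i - r\<bar> = norm ((of_real (\<delta> * s i) - \<kappa>) - (of_real r - \<kappa>))"
      by (simp del: of_real_mult flip: of_real_diff)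
    also have "\<dots> \<le> \<phi> (\<delta> * s i) + \<phi> r"
      unfolding \<phi>_def by (rule norm_triangle_ineq4)
    also have "\<dots> \<le> 2 * a i"
      using min[of "\<delta> * s i"] near[of i] by simp
    finally show ?thesis .
  qed
  show thesis
  proof
    show "a i = (s i - r / \<delta>) - (s (i + 1) - r / \<delta>)" for i
      using s[of i] by simp
    have "s i - r / \<delta> = (\<delta> * s i - r) / \<delta>" for i
      using \<delta> by (simp add: field_simps)
    then have "\<bar>s i - r / \<delta>\<bar> = \<bar>\<delta> * s i - r\<bar> / \<delta>" for i
      using \<delta> by (simp add: abs_divide)
    then show "\<bar>s i - r / \<delta>\<bar> \<le> (2 / \<delta>) * a i" for i
      using close[of i] \<delta> by (simp add: divide_right_mono)
  qed
qed

text \<open>The decreasing sequence \<open>t\<close> is bounded by its own decrements, which forces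
  geometric decay while it is positive and geometric growth of \<open>- t\<close> in general.
  Comparing \<open>a\<close> with \<open>t\<close> transfers this to \<open>a\<close>. The test is
  on \<open>t (j + 1)\<close> since its positivity gives \<open>a j \<le> t j\<close>.\<close>

lemma dichotomy_of_tracking:
  assumes a: "\<And>i. a i = t i - t (i + 1)" and t: "\<And>i. \<bar>t i\<bar> \<le> K * a i"
  shows "dichotomy a {j. t (j + 1) > 0}"
proof -
  define K' where "K' = max K 1"
  have K': "K' \<ge> 1" and t': "\<bar>t i\<bar> \<le> K' * a i" for i
    using t[of i] mult_right_mono[of K K' "a i"] by (auto simp: K'_def)
  \<comment> \<open>Exactly the ratio that \<open>right\<close> yields. On the positive side the
    sharper ratio \<open>(K' - 1) / K'\<close> could be 0; monotonicity of \<open>t\<close> weakens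
    it to this one.\<close>
  define q where "q = K' / (K' + 1)"
  have q: "0 < q" "q < 1" using K' by (auto simp: q_def)
  have dec: "t j \<le> t i" if "i \<le> j" for i j
    using that
  proof (induction j rule: int_ge_induct)
    case (step j)
    then show ?case using a[of j] a_pos[of j] by simp
  qed simp
  have left: "t (i + 1) \<le> q * t i" if "t (i + 1) > 0" for i
  proof -
    have "t i \<le> K' * (t i - t (i + 1))" using t'[of i] a[of i] by simp
    moreover have "t i \<ge> t (i + 1)" using dec by simp
    ultimately have "(K' + 1) * t (i + 1) \<le> K' * t i"
      using that by (simp add: algebra_simps)
    then show ?thesis using K' by (simp add: q_def field_simps)
  qed
  have right: "- t i \<le> q * - t (i + 1)" for i
  proof -
    have "- t i \<le> K' * (t i - t (i + 1))" using t'[of i] a[of i] by simp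
    then show ?thesis using K' by (simp add: q_def field_simps)
  qed
  have lefts: "t j \<le> q ^ n * t (j - int n)" if "t (j + 1) > 0" for j n
  proof (induction n)
    case (Suc n)
    have "t (j - int (Suc n) + 1) > 0"
      using that dec[of "j - int (Suc n) + 1" "j + 1"] by simp
    from left[OF this] have "q ^ n * t (j - int n) \<le> q ^ n * (q * t (j - int (Suc n)))"
      using q by (intro mult_left_mono) (auto simp: algebra_simps)
    then show ?case using Suc by (simp add: algebra_simps)
  qed simp
  have rights: "- t j \<le> q ^ n * - t (j + int n)" for j n
  proof (induction n)
    case (Suc n)
    have "q ^ n * - t (j + int n) \<le> q ^ n * (q * - t (j + int n + 1))"
      using q right by (intro mult_left_mono) auto
    then show ?case using Suc by (simp add: algebra_simps)
  qed simp
  \<comment> \<open>The factor \<open>C / c\<close> pays for a shift by one index, needed at the \<open>j\<close> with \<open>t j > 0 \<ge> t (j + 1)\<close>.\<close>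
  define D where "D = max K' ((K' + 1) * C / c)"
  have "a j \<le> D * q ^ n * a (j - int n)" if j: "t (j + 1) > 0" for j n
  proof -
    have "a j \<le> t j" using j a[of j] by simp
    also have "\<dots> \<le> q ^ n * t (j - int n)" by (rule lefts[OF j])
    also have "\<dots> \<le> q ^ n * (D * a (j - int n))"
    proof (rule mult_left_mono)
      have "t (j - int n) \<le> K' * a (j - int n)" using t'[of "j - int n"] by simp
      also have "\<dots> \<le> D * a (j - int n)" by (rule mult_right_mono) (auto simp: D_def)
      finally show "t (j - int n) \<le> D * a (j - int n)" .
    qed (use q in auto)
    finally show ?thesis by (simp add: algebra_simps)
  qed
  moreover have "a j \<le> D * q ^ n * a (j + int n)" if j: "\<not> t (j + 1) > 0" for j n
  proof -
    have "c * a j \<le> a (j + 1)" by (rule a_step)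
    also have "\<dots> \<le> - t (j + 2)" using j a[of "j + 1"] by (simp add: add.commute)
    also have "\<dots> \<le> q ^ n * - t (j + 2 + int n)" by (rule rights)
    also have "\<dots> \<le> q ^ n * ((K' + 1) * C * a (j + int n))"
    proof (rule mult_left_mono)
      \<comment> \<open>With \<open>i = j + 1 + int n\<close>, this is
        \<open>- t (i + 1) = a i - t i\<close>, where the last term is bounded by
        \<open>K' * a i\<close>.\<close>
      have "- t (j + 2 + int n) \<le> (K' + 1) * a (j + 1 + int n)"
        using t'[of "j + 1 + int n"] a[of "j + 1 + int n"] by (simp add: algebra_simps)
      also have "\<dots> \<le> (K' + 1) * (C * a (j + int n))"
        using K' a_step(2)[of "j + int n"] by (intro mult_left_mono) (auto simp: algebra_simps)
      finally show "- t (j + 2 + int n) \<le> (K' + 1) * C * a (j + int n)"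
        by (simp add: algebra_simps)
    qed (use q in auto)
    finally have "a j \<le> (K' + 1) * C / c * (q ^ n * a (j + int n))"
      using c by (simp add: field_simps)
    also have "\<dots> \<le> D * (q ^ n * a (j + int n))"
      using q by (intro mult_right_mono) (auto simp: D_def)
    finally show ?thesis by (simp add: algebra_simps)
  qed
  ultimately show ?thesis
    unfolding dichotomy_def using q by (intro exI[of _ D] exI[of _ q]) auto
qed

section \<open>Reduction to three index sets\<close>

lemma a_steps: "c ^ n * a i \<le> a (i + int n)" "a (i + int n) \<le> C ^ n * a i"
proof (induction n)
  case (Suc n)
  case 1
  have "c ^ Suc n * a i \<le> c * a (i + int n)"
    using Suc(1) c(1) by (simp add: mult.assoc)
  then show ?case using a_step(1)[of "i + int n"] by (simp add: algebra_simps)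
next
  case (Suc n)
  case 2
  have "C * a (i + int n) \<le> C ^ Suc n * a i"
    using Suc(2) C_pos by (simp add: mult.assoc)
  then show ?case using a_step(2)[of "i + int n"] by (simp add: algebra_simps)
qed auto

text \<open>Each index step changes \<open>a\<close> by a factor between \<open>c\<close> and
  \<open>C\<close>, so shifting by \<open>M\<close> costs at most \<open>(C / c) ^ M\<close> in the
  constant and nothing in the rate.\<close>

lemma dichotomy_shift:
  assumes "dichotomy a J" and J: "\<And>j. j \<in> J' \<Longrightarrow> j - int M \<in> J" "\<And>j. j \<notin> J' \<Longrightarrow> j + int M \<notin> J"
  shows "dichotomy a J'"
proof -
  obtain D q where q: "0 < q" "q < 1"
    and left: "\<And>j n. j \<in> J \<Longrightarrow> a j \<le> D * q ^ n * a (j - int n)"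
    and right: "\<And>j n. j \<notin> J \<Longrightarrow> a j \<le> D * q ^ n * a (j + int n)"
    using assms(1) unfolding dichotomy_def by blast
  have D: "D \<ge> 0"
    using left[of 0 0] right[of 0 0] a_pos[of 0] by (cases "0 \<in> J") auto
  define D' where "D' = (C / c) ^ M * D"
  have "a j \<le> D' * q ^ n * a (j - int n)" if "j \<in> J'" for j n
  proof -
    have "a j \<le> C ^ M * a (j - int M)"
      using a_steps(2)[where i = "j - int M" and n = M] by simp
    also have "\<dots> \<le> C ^ M * (D * q ^ n * a (j - int M - int n))"
      using C_pos left J(1)[OF that] by (intro mult_left_mono) auto
    also have "\<dots> \<le> C ^ M * (D * q ^ n * (a (j - int n) / c ^ M))"
      using a_steps(1)[where i = "j - int M - int n" and n = M] c(1) C_pos D q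
      by (intro mult_left_mono) (auto simp: field_simps)
    finally show ?thesis
      by (simp add: D'_def power_divide mult_ac)
  qed
  moreover have "a j \<le> D' * q ^ n * a (j + int n)" if "j \<notin> J'" for j n
  proof -
    have "c ^ M * a j \<le> a (j + int M)"
      by (rule a_steps)
    also have "\<dots> \<le> D * q ^ n * a (j + int M + int n)"
      using right J(2)[OF that] by auto
    also have "\<dots> \<le> D * q ^ n * (C ^ M * a (j + int n))"
      using a_steps(2)[where i = "j + int n" and n = M] D q
      by (intro mult_left_mono) (auto simp: algebra_simps)
    finally show ?thesis
      using c(1) by (simp add: D'_def power_divide field_simps)
  qed
  ultimately show ?thesis
    unfolding dichotomy_def using q by (intro exI[of _ D'] exI[of _ q]) auto
qed

text \<open>Since \<open>t\<close> decreases, \<open>J\<close> is closed downwards: it is empty,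
  everything, or a half-line whose end can be moved to \<open>-1\<close>.\<close>

lemma shadowing_iff_dichotomy:
  "shadowing_property X N T \<longleftrightarrow> dichotomy a UNIV \<or> dichotomy a {} \<or> dichotomy a {..-1}"
proof
  assume "shadowing_property X N T"
  then obtain K t where a: "\<And>i. a i = t i - t (i + 1)" and t: "\<And>i. \<bar>t i\<bar> \<le> K * a i"
    by (rule real_tracking) blast
  define J where "J = {j. t (j + 1) > 0}"
  have dich: "dichotomy a J"
    unfolding J_def using a t by (rule dichotomy_of_tracking)
  have J_dec: "i \<in> J" if "i + 1 \<in> J" for i
    using that a[of "i + 1"] a_pos[of "i + 1"] unfolding J_def mem_Collect_eq by linarith
  have J_down: "i \<in> J" if "i \<le> j" "j \<in> J" for i j
    using that
  proof (induction i rule: int_le_induct)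
    case (step i)
    then show ?case using J_dec[of "i - 1"] by simp
  qed simp
  consider "J = {}" | "J = UNIV" | i k where "i \<in> J" "k \<notin> J" by blast
  then show "dichotomy a UNIV \<or> dichotomy a {} \<or> dichotomy a {..-1}"
  proof cases
    case (3 i k)
    \<comment> \<open>A shift by \<open>\<bar>i\<bar> + \<bar>k\<bar>\<close> takes every negative
      index to at most \<open>i\<close> and every other index to at least \<open>k\<close>.\<close>
    have "dichotomy a {..-1}"
    proof (rule dichotomy_shift[OF dich])
      fix j :: int assume "j \<in> {..-1}"
      then have "j - int (nat (\<bar>i\<bar> + \<bar>k\<bar>)) \<le> i" by simp
      then show "j - int (nat (\<bar>i\<bar> + \<bar>k\<bar>)) \<in> J" using 3 J_down by blast
    next
      fix j :: int assume "j \<notin> {..-1}"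
      then have "k \<le> j + int (nat (\<bar>i\<bar> + \<bar>k\<bar>))" by simp
      then show "j + int (nat (\<bar>i\<bar> + \<bar>k\<bar>)) \<notin> J" using 3 J_down by blast
    qed
    then show ?thesis by blast
  qed (use dich in auto)
qed (use shadowing_of_dichotomy in blast)

section \<open>Dichotomies as decay of weight products\<close>

lemma a_prod: "a (j + int n) = a j * (\<Prod>i<n. norm (w (j + 1 + int i)))"
proof (induction n)
  case (Suc n)
  have "a (j + int (Suc n)) = norm (w (j + 1 + int n)) * a (j + int n)"
    using H_step[of "j + int n"] by (simp add: norm_mult add_ac)
  then show ?case using Suc by (simp add: mult_ac)
qed simp

lemma a_prod_rev: "a j = a (j - int n) * (\<Prod>i<n. norm (w (j - int i)))"
proof (induction n)
  case (Suc n)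
  have "a (j - int n) = norm (w (j - int n)) * a (j - int (Suc n))"
    using H_step[of "j - int (Suc n)"] by (simp add: norm_mult algebra_simps)
  then show ?case using Suc by (simp add: mult_ac)
qed simp

text \<open>Reads the quotient as a product running down from \<open>j\<close>, the form of the left
  half of (C); the primed version runs upwards, as in (A).\<close>

lemma left_bound_iff:
  "a j \<le> r * a (j - int n) \<longleftrightarrow> (\<Prod>i<n. norm (w (j - int i))) \<le> r"
  using a_pos[of "j - int n"] by (subst a_prod_rev[of j n]) (simp add: mult.commute)

lemma left_bound_iff':
  "a (j + int n) \<le> r * a j \<longleftrightarrow> (\<Prod>i<n. norm (w (j + 1 + int i))) \<le> r"
  using a_pos[of j] by (subst a_prod) (simp add: mult.commute)

lemma right_bound_iff:
  "a j \<le> r * a (j + int n) \<longleftrightarrow> (\<Prod>i<n. inverse (norm (w (j + 1 + int i)))) \<le> r"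
proof -
  define P where "P = (\<Prod>i<n. norm (w (j + 1 + int i)))"
  have "P > 0"
    unfolding P_def by (intro prod_pos) (simp add: w_nz)
  moreover have inv: "(\<Prod>i<n. inverse (norm (w (j + 1 + int i)))) = inverse P"
    unfolding P_def by (rule prod_inversef[unfolded o_def])
  moreover have "a (j + int n) = a j * P"
    unfolding P_def by (rule a_prod)
  ultimately show ?thesis
    using a_pos[of j] unfolding inv by (simp add: field_simps)
qed

text \<open>As \<open>j\<close> ranges over all integers, so does the first index
  \<open>k = j - n + 1\<close> of the product.\<close>

lemma dichotomy_UNIV_iff: "dichotomy a UNIV \<longleftrightarrow> exp_decay (\<lambda>i. norm (w i)) UNIV"
proof -
  have "(\<forall>j n. a j \<le> D * q ^ n * a (j - int n)) \<longleftrightarrow>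
      (\<forall>k n. (\<Prod>i<n. norm (w (k + int i))) \<le> D * q ^ n)" for D q
  proof
    assume *: "\<forall>j n. a j \<le> D * q ^ n * a (j - int n)"
    show "\<forall>k n. (\<Prod>i<n. norm (w (k + int i))) \<le> D * q ^ n"
    proof (intro allI)
      fix k n
      have "a (k - 1 + int n) \<le> D * q ^ n * a (k - 1)"
        using *[rule_format, of "k - 1 + int n" n] by simp
      then show "(\<Prod>i<n. norm (w (k + int i))) \<le> D * q ^ n"
        unfolding left_bound_iff' by simp
    qed
  next
    assume *: "\<forall>k n. (\<Prod>i<n. norm (w (k + int i))) \<le> D * q ^ n"
    show "\<forall>j n. a j \<le> D * q ^ n * a (j - int n)"
    proof (intro allI)
      fix j n
      show "a j \<le> D * q ^ n * a (j - int n)"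
        using left_bound_iff'[of "j - int n" n "D * q ^ n"] *[rule_format, where k = "j - int n + 1" and n = n] by simp
    qed
  qed
  then show ?thesis
    by (simp add: dichotomy_def exp_decay_def)
qed

lemma dichotomy_empty_iff: "dichotomy a {} \<longleftrightarrow> exp_decay (\<lambda>i. inverse (norm (w i))) UNIV"
proof -
  have "(\<forall>j n. a j \<le> D * q ^ n * a (j + int n)) \<longleftrightarrow>
      (\<forall>k n. (\<Prod>i<n. inverse (norm (w (k + int i)))) \<le> D * q ^ n)" for D q
    unfolding right_bound_iff by (metis diff_add_cancel)
  then show ?thesis
    by (simp add: dichotomy_def exp_decay_def)
qed

text \<open>Cutting at \<open>-1\<close> makes both halves start at 1: \<open>k = - j\<close> on the
  left and \<open>k = j + 1\<close> on the right.\<close>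

lemma dichotomy_negative_iff:
  "dichotomy a {..-1} \<longleftrightarrow>
    exp_decay (\<lambda>i. norm (w (- i))) {1..} \<and> exp_decay (\<lambda>i. inverse (norm (w i))) {1..}"
proof
  assume "dichotomy a {..-1}"
  then obtain D q where q: "0 < q" "q < 1"
    and left: "\<And>j n. j \<in> {..-1} \<Longrightarrow> a j \<le> D * q ^ n * a (j - int n)"
    and right: "\<And>j n. j \<notin> {..-1} \<Longrightarrow> a j \<le> D * q ^ n * a (j + int n)"
    unfolding dichotomy_def by blast
  have "(\<Prod>i<n. norm (w (- (k + int i)))) \<le> D * q ^ n" if "k \<ge> 1" for k n
    using left[of "- k" n] that unfolding left_bound_iff by simp
  moreover have "(\<Prod>i<n. inverse (norm (w (k + int i)))) \<le> D * q ^ n" if "k \<ge> 1" for k n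
    using right[of "k - 1" n] that unfolding right_bound_iff by simp
  ultimately show "exp_decay (\<lambda>i. norm (w (- i))) {1..} \<and> exp_decay (\<lambda>i. inverse (norm (w i))) {1..}"
    unfolding exp_decay_def using q by (intro conjI exI[of _ D] exI[of _ q]) auto
next
  assume "exp_decay (\<lambda>i. norm (w (- i))) {1..} \<and> exp_decay (\<lambda>i. inverse (norm (w i))) {1..}"
  then obtain D1 q1 D2 q2 where q: "0 < q1" "q1 < 1" "0 < q2" "q2 < 1"
    and left: "\<And>k n. k \<in> {1..} \<Longrightarrow> (\<Prod>i<n. norm (w (- (k + int i)))) \<le> D1 * q1 ^ n"
    and right: "\<And>k n. k \<in> {1..} \<Longrightarrow> (\<Prod>i<n. inverse (norm (w (k + int i)))) \<le> D2 * q2 ^ n"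
    unfolding exp_decay_def by blast
  define D q where "D = max D1 D2" and "q = max q1 q2"
  \<comment> \<open>The empty product, \<open>n = 0\<close>, gives these bounds; the signs are
    needed to compare with the maxima.\<close>
  have D12: "D1 \<ge> 1" "D2 \<ge> 1" using left[of 1 0] right[of 1 0] by auto
  have le: "D1 * q1 ^ n \<le> D * q ^ n" "D2 * q2 ^ n \<le> D * q ^ n" for n
    using D12 q by (auto simp: D_def q_def intro!: mult_mono power_mono)
  have "a j \<le> D * q ^ n * a (j - int n)" if "j \<le> - 1" for j n
    using order_trans[OF left[of "- j" n] le(1)] that unfolding left_bound_iff by simp
  moreover have "a j \<le> D * q ^ n * a (j + int n)" if "\<not> j \<le> - 1" for j n
    using order_trans[OF right[of "j + 1" n] le(2)] that unfolding right_bound_iff by simp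
  ultimately show "dichotomy a {..-1}"
    unfolding dichotomy_def using q by (intro exI[of _ D] exI[of _ q]) (auto simp: q_def)
qed

end

section \<open>Weight products and the characterization of shadowing\<close>

lemma weight_product_exists:
  fixes w :: "int \<Rightarrow> 'a::field"
  assumes w: "\<And>i. w i \<noteq> 0"
  obtains H where "\<And>i. H i \<noteq> 0" "\<And>i. H (i + 1) = w (i + 1) * H i"
proof
  define H where "H i = (if i \<ge> 0 then \<Prod>j\<in>{1..i}. w j else inverse (\<Prod>j\<in>{i + 1..0}. w j))" for i
  show "H i \<noteq> 0" for i
    by (simp add: H_def w)
  show "H (i + 1) = w (i + 1) * H i" for i
  proof (cases "i \<ge> 0")
    case True
    then have "{1..i + 1} = insert (i + 1) {1..i}" by auto
    with True show ?thesis by (simp add: H_def)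
  next
    case False
    then have *: "{i + 1..0} = insert (i + 1) {i + 1 + 1..0}" by auto
    have "H i = inverse (w (i + 1)) * inverse (\<Prod>j\<in>{i + 1 + 1..0}. w j)"
      using False unfolding H_def * by simp
    \<comment> \<open>At \<open>i = - 1\<close> the two branches of \<open>H\<close> meet; both
      products are empty there.\<close>
    moreover have "H (i + 1) = inverse (\<Prod>j\<in>{i + 1 + 1..0}. w j)"
    proof (cases "i = - 1")
      case False
      with \<open>\<not> i \<ge> 0\<close> have "\<not> i + 1 \<ge> 0" by simp
      then show ?thesis unfolding H_def by simp
    qed (simp add: H_def)
    ultimately show ?thesis using w[of "i + 1"] by simp
  qed
qed

text \<open>The scalars form any complete real normed field, which includes the real and complex
  numbers. Existence of the limit is part of each condition. At \<open>n = 0\<close> the exponent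
  \<open>1 / real n\<close> is 0, which does not affect the limits.\<close>

theorem theorem17:
  fixes w :: "int \<Rightarrow> 'a::{real_normed_field, banach}"
    and X :: "(int \<Rightarrow> 'a) set"
    and N :: "(int \<Rightarrow> 'a) \<Rightarrow> real"
  assumes space: "(\<exists>p\<ge>1. X = lp_space p \<and> N = lp_norm p) \<or> (X = c0_space \<and> N = c0_norm)"
    and bdd: "bounded (range w)"
    and pos: "(INF n. norm (w n)) > 0"
  shows "shadowing_property X N (weighted_backward_shift w) \<longleftrightarrow>
    \<comment> \<open>(A)\<close>
    (\<exists>L<1. (\<lambda>n. SUP k::int. norm (\<Prod>j\<le>n. w (k + int j)) powr (1 / real n)) \<longlonglongrightarrow> L)
    \<comment> \<open>(B)\<close>
    \<or> (\<exists>L>1. (\<lambda>n. INF k::int. norm (\<Prod>j\<le>n. w (k + int j)) powr (1 / real n)) \<longlonglongrightarrow> L)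
    \<comment> \<open>(C)\<close>
    \<or> ((\<exists>L<1. (\<lambda>n. SUP k\<in>{1::int..}. norm (\<Prod>j\<le>n. w (- k - int j)) powr (1 / real n)) \<longlonglongrightarrow> L)
       \<and> (\<exists>L>1. (\<lambda>n. INF k\<in>{1::int..}. norm (\<Prod>j\<le>n. w (k + int j)) powr (1 / real n)) \<longlonglongrightarrow> L))"
proof -
  define c where "c = (INF n. norm (w n))"
  have c: "c > 0" "c \<le> norm (w i)" for i
    using pos by (auto simp: c_def intro!: cINF_lower bdd_belowI2[of _ 0])
  obtain C where C: "\<And>i. norm (w i) \<le> C"
    using bdd by (auto simp: bounded_iff)
  have "w i \<noteq> 0" for i
    using c(1) c(2)[of i] by auto
  then obtain H where H: "\<And>i. H i \<noteq> 0" "\<And>i. H (i + 1) = w (i + 1) * H i"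
    using weight_product_exists by blast
  interpret shift_space X N
    using space shift_space_lp shift_space_c0 by blast
  interpret weighted_shift X N w H c C
    by unfold_locales (use c C H in auto)
  \<comment> \<open>Reflecting the weights to \<open>w (- i)\<close> turns the downward products
    into upward ones over the positive integers.\<close>
  have left: "(\<exists>L<1. (\<lambda>n. SUP k\<in>{1::int..}. norm (\<Prod>j\<le>n. w (- k - int j)) powr (1 / real n)) \<longlonglongrightarrow> L)
      \<longleftrightarrow> exp_decay (\<lambda>i. norm (w (- i))) {1..}"
    using SUP_limit_iff_exp_decay[where v = "\<lambda>i. w (- i)" and K = "{1..}", OF c C] by simp
  show ?thesis
    unfolding shadowing_iff_dichotomy dichotomy_UNIV_iff dichotomy_empty_iff dichotomy_negative_iff left
    using SUP_limit_iff_exp_decay[where v = w and K = UNIV, OF c C]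
      INF_limit_iff_exp_decay[where v = w and K = UNIV, OF c C]
      INF_limit_iff_exp_decay[where v = w and K = "{1..}", OF c C]
    by simp
qed

end
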